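(* Let $(B_i)_{i\ge 1}$ be i.i.d. nonnegative random variables with $\mathbb{E}[B_1]<1$, and let $a>0$ be a fixed constant. For $x>0$ define $$P_a(x)=\mathbb{P}\left(\sup_{n\ge 0}\sum_{i=1}^n\left[B_i\,I(B_i<ax)-1\right]>x\right).$$ Suppose that $\mathbb{P}(B_1>x)=L(x)x^{-\alpha}$ with $\alpha>1$, where $L(tx)/L(x)\to 1$ as $x\to\infty$ for every $t>0$, and that $1/a$ is not an integer. Then there exists a constant $C\in(0,\infty)$ such that $$P_a(x)=\left(L(x)x^{-(\alpha-1)}\right)^{\lceil 1/a\rceil}C\,(1+o(1))\qquad\text{as } x\to\infty .$$
   Context: $I(\cdot)$ denotes the indicator function, and the empty sum ($n=0$) equals $0$. $P_a(x)$ is the infinite-time ruin probability, with initial capital $x$, in an insurance risk model with premium rate $c>0$, claim sizes $B_i$ and inter-claim times $A_i\equiv 1/c$ (so that $cA_i=1$), where claims exceeding the value $ax$ are covered by a re-insurer. The condition $\mathbb{E}[B_1]<1$ is the net-profit condition $c\,\mathbb{E}[A_1]>\mathbb{E}[B_1]$. The constant $C$ does not depend on $x$. *)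

theory Defs
  imports "HOL-Probability.Probability" "HOL-Library.Landau_Symbols"
begin

(* A tail function L automatically has the measurability usually required of slowly varying
   functions.  Division by zero is harmless: the limit forces L to be eventually nonzero. *)
definition slowly_varying :: "(real \<Rightarrow> real) \<Rightarrow> bool" where
  "slowly_varying L \<longleftrightarrow> (\<forall>t>0. ((\<lambda>x. L (t * x) / L x) \<longlongrightarrow> 1) at_top)"

(* Claims are B 1, B 2, ...; B 0 is never used. *)
definition reinsured_walk :: "(nat \<Rightarrow> 'a \<Rightarrow> real) \<Rightarrow> real \<Rightarrow> real \<Rightarrow> nat \<Rightarrow> 'a \<Rightarrow> real" where
  "reinsured_walk B a x n \<omega> = (\<Sum>i=1..n. (B i \<omega> * indicator {..<a * x} (B i \<omega>) - 1))"

(* The supremum is taken in ereal, since the real-valued Sup of an unbounded set is unspecified. *)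
definition ruin_prob :: "'a measure \<Rightarrow> (nat \<Rightarrow> 'a \<Rightarrow> real) \<Rightarrow> real \<Rightarrow> real \<Rightarrow> real" where
  "ruin_prob M B a x =
     measure M {\<omega> \<in> space M. (SUP n. ereal (reinsured_walk B a x n \<omega>)) > ereal x}"

end

theory Submission
  imports Defs "HOL-Real_Asymp.Real_Asymp"
begin

text \<open>
  Every retained claim is below \<open>a x\<close>, so with \<open>k = \<lceil>1/a\<rceil>\<close> the level \<open>x\<close> can only be crossed with the help
  of at least \<open>k\<close> claims of order \<open>x\<close>; the remaining claims make the walk follow the line of slope
  \<open>\<mu> - 1\<close>, where \<open>\<mu>\<close> is the mean claim.  Up to errors of smaller order, ruin therefore happens iff for some
  set \<open>I\<close> of \<open>k\<close> indices the claims in \<open>I\<close> are below \<open>a x\<close> and sum to more than \<open>x + (1 - \<mu>) max I\<close>.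
  These events are asymptotically disjoint.  Writing \<open>V\<close> for the tail of the claim law, summing their
  probabilities over \<open>I\<close> gives a \<open>k\<close>-fold convolution integral, which after scaling by \<open>(x V(x))\<^sup>k\<close> converges
  because the claim law on the scale \<open>x\<close>, divided by \<open>V(x)\<close>, converges to the density
  \<open>\<alpha> z powr (- \<alpha> - 1)\<close>.

  Fewer than \<open>k\<close> large claims are excluded by an exponential Markov inequality at rate \<open>ln x / x\<close> for
  claims truncated at a small multiple of \<open>x\<close>, which makes the error smaller than any prescribed power of
  \<open>x\<close>; more than \<open>k\<close> large claims cost an extra factor \<open>x V(x)\<close>.
\<close>


section \<open>Antitone functions and continuous convergence\<close>

text \<open>Ruin is best timed at \<open>max I\<close>, since waiting longer only adds negative
  drift. The event attached to \<open>I\<close> thus depends on \<open>I\<close> only through its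
  size and its maximum, and the sum over \<open>I\<close> can be taken before integrating: it
  becomes one counting function, to which \<open>k\<close> convolutions are applied. The obstacle is
  that this function is an integer-valued step function that changes with \<open>x\<close>, while
  the claim law may have atoms, so weak convergence against one fixed continuous test function is
  not enough. Continuous convergence tolerates moving integrands and survives every convolution;
  antitonicity supplies measurability and domination. That \<open>1 / a\<close> is not an integer
  enters as \<open>(k - 1) * a < 1 < k * a\<close>: the left inequality keeps the window away from
  0, the right one makes the limiting constant positive. A slack \<eta> in both level and slope
  sandwiches the ruin probability, and continuity of the limit in the level removes it.\<close>

lemma borel_measurable_antimono:
  fixes f :: "real \<Rightarrow> real"
  assumes "antimono f"
  shows "f \<in> borel_measurable borel"
proof -
  have "mono (\<lambda>x. - f x)"
    using assms by (auto simp: mono_def antimono_def)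
  then have "(\<lambda>x. - f x) \<in> borel_measurable borel"
    by (rule borel_measurable_mono)
  then show ?thesis
    by (simp add: borel_measurable_uminus_eq)
qed

text \<open>Convolution with the restriction of \<open>D\<close> to \<open>A\<close>. The argument
  is the level still to be exceeded: a claim \<open>z\<close> lowers it from \<open>u\<close> to
  \<open>u - z\<close>. The operator form lets \<open>k\<close> claims be handled by
  \<open>^^\<close>.\<close>

definition smear :: "real measure \<Rightarrow> real set \<Rightarrow> (real \<Rightarrow> real) \<Rightarrow> real \<Rightarrow> real" where
  "smear D A \<phi> u = (\<integral>z. indicator A z * \<phi> (u - z) \<partial>D)"

text \<open>The invariant class of the convolutions. Monotonicity gives measurability, and for a
  window bounded above by \<open>b\<close> it gives
  \<open>\<phi> (u - z) \<le> \<phi> (u - b)\<close>, hence integrability without any growth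
  condition.\<close>

definition antimono_nonneg :: "(real \<Rightarrow> real) \<Rightarrow> bool" where
  "antimono_nonneg \<phi> \<longleftrightarrow> antimono \<phi> \<and> (\<forall>u. 0 \<le> \<phi> u)"

lemma antimono_nonnegD:
  assumes "antimono_nonneg \<phi>"
  shows "x \<le> y \<Longrightarrow> \<phi> y \<le> \<phi> x" "0 \<le> \<phi> x" "\<phi> \<in> borel_measurable borel"
  using assms by (auto simp: antimono_nonneg_def antimono_def intro!: borel_measurable_antimono)

context
  fixes D :: "real measure" and A :: "real set" and b :: real
  assumes D: "finite_measure D" "sets D = sets borel"
    and A: "A \<in> sets borel" "A \<subseteq> {..b}"
begin

lemma integrable_smear:
  assumes "antimono_nonneg \<phi>"
  shows "integrable D (\<lambda>z. indicator A z * \<phi> (u - z))"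
proof (rule finite_measure.integrable_const_bound[OF D(1), where B = "\<phi> (u - b)"])
  have "\<bar>indicator A z * \<phi> (u - z)\<bar> \<le> \<phi> (u - b)" for z
    using A antimono_nonnegD[OF assms] by (auto simp: indicator_def abs_le_iff order_trans[of "- _" 0])
  then show "AE z in D. norm (indicator A z * \<phi> (u - z)) \<le> \<phi> (u - b)"
    by simp
  show "(\<lambda>z. indicator A z * \<phi> (u - z)) \<in> borel_measurable D"
    using antimono_nonnegD(3)[OF assms] A D by measurable
qed

lemma antimono_nonneg_smear:
  assumes "antimono_nonneg \<phi>"
  shows "antimono_nonneg (smear D A \<phi>)"
  unfolding antimono_nonneg_def antimono_def smear_def using antimono_nonnegD[OF assms]
  by (auto intro!: integral_mono integrable_smear[OF assms] mult_left_mono)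

lemma antimono_nonneg_smear_funpow:
  "antimono_nonneg \<phi> \<Longrightarrow> antimono_nonneg ((smear D A ^^ k) \<phi>)"
  by (induction k) (auto intro: antimono_nonneg_smear)

lemma smear_funpow_sum:
  assumes "\<And>i. i \<in> S \<Longrightarrow> antimono_nonneg (\<phi> i)"
  shows "(smear D A ^^ k) (\<lambda>u. \<Sum>i\<in>S. \<phi> i u) = (\<lambda>u. \<Sum>i\<in>S. (smear D A ^^ k) (\<phi> i) u)"
proof (induction k)
  case (Suc k)
  have "smear D A (\<lambda>u. \<Sum>i\<in>S. (smear D A ^^ k) (\<phi> i) u) u = (\<Sum>i\<in>S. smear D A ((smear D A ^^ k) (\<phi> i)) u)"
    for u
  proof -
    define f where "f i = (smear D A ^^ k) (\<phi> i)" for i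
    have "antimono_nonneg (f i)" if "i \<in> S" for i
      unfolding f_def by (intro antimono_nonneg_smear_funpow assms that)
    then show ?thesis
      unfolding f_def[symmetric] smear_def sum_distrib_left
      by (intro Bochner_Integration.integral_sum integrable_smear)
  qed
  then show ?case by (simp add: Suc)
qed simp

text \<open>Each convolution lowers the argument by at most \<open>b\<close>, so the value at
  \<open>u\<close> sees the function only from \<open>u - k * b\<close> on. This permits replacing a
  finite sum by a counting function that agrees with it only there.\<close>

lemma smear_funpow_cong:
  assumes "\<And>v. v \<ge> u - real k * b \<Longrightarrow> \<phi> v = \<psi> v"
  shows "(smear D A ^^ k) \<phi> u = (smear D A ^^ k) \<psi> u"
  using assms
proof (induction k arbitrary: u)
  case (Suc k)
  have "indicator A z * (smear D A ^^ k) \<phi> (u - z) = indicator A z * (smear D A ^^ k) \<psi> (u - z)" for z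
  proof (cases "z \<in> A")
    case True
    then have "z \<le> b" using A by auto
    then have "(smear D A ^^ k) \<phi> (u - z) = (smear D A ^^ k) \<psi> (u - z)"
      by (intro Suc.IH Suc.prems) (auto simp: algebra_simps)
    then show ?thesis by simp
  qed simp
  then have "smear D A ((smear D A ^^ k) \<phi>) u = smear D A ((smear D A ^^ k) \<psi>) u"
    by (subst (1 2) smear_def) (rule Bochner_Integration.integral_cong[OF refl])
  then show ?case by simp
qed simp

end

lemma smear_funpow_shift:
  "(smear D A ^^ k) (\<lambda>u. \<phi> (u + d)) u = (smear D A ^^ k) \<phi> (u + d)"
proof (induction k arbitrary: u)
  case (Suc k)
  have "(smear D A ^^ k) (\<lambda>u. \<phi> (u + d)) = (\<lambda>u. (smear D A ^^ k) \<phi> (u + d))"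
    using Suc by auto
  moreover have "smear D A (\<lambda>u. f (u + d)) u = smear D A f (u + d)" for f
    by (simp add: smear_def algebra_simps)
  ultimately show ?case by simp
qed simp

text \<open>Stronger than pointwise convergence, as the arguments may move with \<open>n\<close>.
  After coupling, the integrands are evaluated at such moving points. For a constant sequence the
  notion is sequential continuity.\<close>

definition continuously_converges :: "(nat \<Rightarrow> real \<Rightarrow> real) \<Rightarrow> (real \<Rightarrow> real) \<Rightarrow> bool" where
  "continuously_converges F G \<longleftrightarrow> (\<forall>h l. h \<longlonglongrightarrow> l \<longrightarrow> (\<lambda>n. F n (h n)) \<longlonglongrightarrow> G l)"

lemma continuously_convergesD:
  "continuously_converges F G \<Longrightarrow> h \<longlonglongrightarrow> l \<Longrightarrow> (\<lambda>n. F n (h n)) \<longlonglongrightarrow> G l"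
  by (auto simp: continuously_converges_def)

lemma continuously_converges_antimono_nonneg:
  assumes "continuously_converges F G" "\<And>n. antimono_nonneg (F n)"
  shows "antimono_nonneg G"
  unfolding antimono_nonneg_def antimono_def
proof safe
  have lim: "(\<lambda>n. F n x) \<longlonglongrightarrow> G x" for x
    by (rule continuously_convergesD[OF assms(1) tendsto_const])
  show "G y \<le> G x" if "x \<le> y" for x y
    using antimono_nonnegD(1)[OF assms(2) that] by (intro LIMSEQ_le[OF lim lim]) auto
  show "0 \<le> G x" for x
    using antimono_nonnegD(2)[OF assms(2)] by (intro LIMSEQ_le[OF tendsto_const lim]) auto
qed

text \<open>Skorohod's representation turns weak convergence into pointwise convergence, which
  continuous convergence of the integrands is made for.\<close>
lemma continuously_converges_convolution:
  fixes Q :: "nat \<Rightarrow> real measure"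
  assumes Q: "\<And>n. real_distribution (Q n)" "real_distribution Q0" "weak_conv_m Q Q0"
    and bound: "\<And>n. AE w in Q n. w \<le> b"
    and F: "\<And>n. antimono_nonneg (F n)" "continuously_converges F G"
  shows "continuously_converges (\<lambda>n u. \<integral>w. F n (u - w) \<partial>Q n) (\<lambda>u. \<integral>w. G (u - w) \<partial>Q0)"
  unfolding continuously_converges_def
proof safe
  fix h :: "nat \<Rightarrow> real" and l
  assume h: "h \<longlonglongrightarrow> l"
  obtain \<Omega> Ys and Y :: "real \<Rightarrow> real" where \<Omega>: "prob_space \<Omega>"
    and Ys [measurable]: "\<And>n. Ys n \<in> measurable \<Omega> borel" and dYs: "\<And>n. distr \<Omega> borel (Ys n) = Q n"
    and Y: "Y \<in> measurable \<Omega> lborel" and dY: "distr \<Omega> borel Y = Q0"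
    and lim: "\<And>x. x \<in> space \<Omega> \<Longrightarrow> (\<lambda>n. Ys n x) \<longlonglongrightarrow> Y x"
    using Skorohod[of Q Q0] Q by blast
  have Y' [measurable]: "Y \<in> measurable \<Omega> borel" using Y by simp
  have G: "antimono_nonneg G"
    by (rule continuously_converges_antimono_nonneg[OF F(2,1)])
  note [measurable] = antimono_nonnegD(3)[OF F(1)] antimono_nonnegD(3)[OF G]
  have eq: "(\<integral>w. F n (h n - w) \<partial>Q n) = (\<integral>\<omega>. F n (h n - Ys n \<omega>) \<partial>\<Omega>)" for n
    unfolding dYs[symmetric] by (rule integral_distr) measurable
  have eq0: "(\<integral>w. G (l - w) \<partial>Q0) = (\<integral>\<omega>. G (l - Y \<omega>) \<partial>\<Omega>)"
    unfolding dY[symmetric] by (rule integral_distr) measurable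
  \<comment> \<open>A constant dominating function: almost surely \<open>w \<le> b\<close>, so
    antitonicity bounds the integrand by \<open>F n (h n - b)\<close>, a convergent and hence
    bounded sequence.\<close>
  have "(\<lambda>n. F n (h n - b)) \<longlonglongrightarrow> G (l - b)"
    by (intro continuously_convergesD[OF F(2)] tendsto_intros h)
  then have "Bseq (\<lambda>n. F n (h n - b))"
    by (rule convergent_imp_Bseq[OF convergentI])
  then obtain K where K: "\<And>n. \<bar>F n (h n - b)\<bar> \<le> K"
    by (auto simp: Bseq_def)
  interpret \<Omega>: prob_space \<Omega> by fact
  show "(\<lambda>n. \<integral>w. F n (h n - w) \<partial>Q n) \<longlonglongrightarrow> (\<integral>w. G (l - w) \<partial>Q0)"
    unfolding eq eq0
  proof (rule integral_dominated_convergence[where w = "\<lambda>_. K"])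
    show "AE \<omega> in \<Omega>. (\<lambda>n. F n (h n - Ys n \<omega>)) \<longlonglongrightarrow> G (l - Y \<omega>)"
      by (intro AE_I2 continuously_convergesD[OF F(2)] tendsto_intros h lim)
    fix n
    have "AE \<omega> in \<Omega>. Ys n \<omega> \<le> b"
      using bound[of n] unfolding dYs[symmetric] by (subst (asm) AE_distr_iff) auto
    then show "AE \<omega> in \<Omega>. norm (F n (h n - Ys n \<omega>)) \<le> K"
    proof eventually_elim
      case (elim \<omega>)
      then show ?case
        using antimono_nonnegD(1)[OF F(1)[of n], of "h n - b" "h n - Ys n \<omega>"]
          antimono_nonnegD(2)[OF F(1)[of n], of "h n - Ys n \<omega>"] K[of n] by auto
    qed
  qed measurable
qed

text \<open>For \<open>k > 0\<close> this is the number of \<open>k\<close>-element sets \<open>I\<close> of positive integers with \<open>u + c max I < 0\<close>;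
  for \<open>u \<ge> 0\<close> the truncation by \<^term>\<open>nat\<close> correctly gives \<open>0\<close>.\<close>
definition subset_count :: "nat \<Rightarrow> real \<Rightarrow> real \<Rightarrow> real" where
  "subset_count k c u = real (nat (\<lceil>- u / c\<rceil> - 1) choose k)"

lemma antimono_nonneg_subset_count:
  assumes "c > 0"
  shows "antimono_nonneg (subset_count k c)"
  unfolding antimono_nonneg_def antimono_def subset_count_def
proof safe
  fix x y :: real
  assume "x \<le> y"
  then have "\<lceil>- y / c\<rceil> \<le> \<lceil>- x / c\<rceil>"
    using assms by (intro ceiling_mono divide_right_mono) auto
  then show "real (nat (\<lceil>- y / c\<rceil> - 1) choose k) \<le> real (nat (\<lceil>- x / c\<rceil> - 1) choose k)"
    by (intro of_nat_mono binomial_right_mono nat_mono) auto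
qed simp

text \<open>Rounding costs at most 1, which vanishes after division by \<open>x n\<close>. The
  binomial coefficient is a product of \<open>k\<close> factors \<open>r - i\<close> over
  \<open>k!\<close>; divided by \<open>x n ^ k\<close>, each factor has the same limit because
  \<open>i / x n\<close> tends to 0.\<close>

lemma subset_count_limit:
  assumes c: "c > 0" and k: "k > 0" and x: "filterlim x at_top sequentially" "\<And>n. x n > 0"
  shows "continuously_converges (\<lambda>n h. subset_count k c (h * x n) / x n ^ k)
           (\<lambda>h. max 0 (- h / c) ^ k / fact k)"
  unfolding continuously_converges_def
proof safe
  fix h :: "nat \<Rightarrow> real" and l
  assume h: "h \<longlonglongrightarrow> l"
  define r where "r n = nat (\<lceil>- (h n * x n) / c\<rceil> - 1)" for n
  have inv: "(\<lambda>n. C / x n) \<longlonglongrightarrow> 0" for C :: real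
    by (intro real_tendsto_divide_at_top[OF tendsto_const x(1)])
  have r0: "(\<lambda>n. real (r n) / x n - max 0 (- h n / c)) \<longlonglongrightarrow> 0"
  proof (rule Lim_null_comparison[OF _ inv[of 1]], rule always_eventually, rule allI)
    fix n
    have "\<bar>real (r n) - max 0 (- (h n * x n) / c)\<bar> \<le> 1"
      unfolding r_def by linarith
    then have "\<bar>real (r n) - max 0 (- (h n * x n) / c)\<bar> / x n \<le> 1 / x n"
      by (intro divide_right_mono) (use x(2) in \<open>auto intro: less_imp_le\<close>)
    moreover have "real (r n) / x n - max 0 (- h n / c) = (real (r n) - max 0 (- (h n * x n) / c)) / x n"
      using x(2)[of n] max_divide_distrib_right[of 0 "- (h n * x n) / c" "x n"]
      by (simp add: diff_divide_distrib)
    ultimately show "norm (real (r n) / x n - max 0 (- h n / c)) \<le> 1 / x n"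
      using x(2)[of n] by (simp add: abs_divide)
  qed
  have "(\<lambda>n. (real (r n) / x n - max 0 (- h n / c)) + max 0 (- h n / c)) \<longlonglongrightarrow> 0 + max 0 (- l / c)"
    using c by (intro tendsto_intros r0 h) auto
  then have r: "(\<lambda>n. real (r n) / x n) \<longlonglongrightarrow> max 0 (- l / c)" by simp
  have "(\<lambda>n. (\<Prod>i<k. real (r n) / x n - real i / x n) / fact k) \<longlonglongrightarrow> (\<Prod>i<k. max 0 (- l / c) - 0) / fact k"
    by (intro tendsto_intros r inv) auto
  moreover have "(\<Prod>i<k. real (r n) / x n - real i / x n) / fact k = subset_count k c (h n * x n) / x n ^ k" for n
  proof -
    have "subset_count k c (h n * x n) = (\<Prod>i<k. real (r n) - real i) / fact k"
      unfolding subset_count_def r_def[symmetric] binomial_gbinomial gbinomial_prod_rev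
      by (simp add: atLeast0LessThan)
    then show ?thesis
      by (simp add: diff_divide_distrib[symmetric] prod_dividef)
  qed
  ultimately show "(\<lambda>n. subset_count k c (h n * x n) / x n ^ k) \<longlonglongrightarrow> max 0 (- l / c) ^ k / fact k"
    by simp
qed


section \<open>Regularly varying tails\<close>

text \<open>Regular variation is stated through ratios of the tail itself, which hides the slowly
  varying factor.\<close>

locale heavy_tail = real_distribution D for D :: "real measure" +
  fixes \<alpha> :: real
  assumes alpha_pos: "\<alpha> > 0"
    and tail_pos: "\<And>x. measure D {x<..} > 0"
    and tail_regular: "\<And>t. t > 0 \<Longrightarrow>
      ((\<lambda>x. measure D {t * x<..} / measure D {x<..}) \<longlongrightarrow> t powr - \<alpha>) at_top"
begin

abbreviation V :: "real \<Rightarrow> real" where "V x \<equiv> measure D {x<..}"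

lemma V_antimono: "x \<le> y \<Longrightarrow> V y \<le> V x"
  by (intro finite_measure_mono) auto

text \<open>The retained claims lie strictly below \<open>a * x\<close>, so the closed tail is
  needed and atoms cannot be ruled out. It lies between \<open>V (t * x)\<close> and
  \<open>V (s * x)\<close> for every \<open>s < t\<close>; then \<open>s\<close> tends to
  \<open>t\<close>.\<close>

lemma tail_closed_limit:
  assumes t: "t > 0"
  shows "((\<lambda>x. measure D {t * x..} / V x) \<longlongrightarrow> t powr - \<alpha>) at_top"
proof (rule order_tendstoI)
  fix y assume y: "y < t powr - \<alpha>"
  have "\<forall>\<^sub>F x in at_top. y < V (t * x) / V x"
    by (rule order_tendstoD(1)[OF tail_regular[OF t] y])
  then show "\<forall>\<^sub>F x in at_top. y < measure D {t * x..} / V x"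
  proof eventually_elim
    case (elim x)
    have "V (t * x) \<le> measure D {t * x..}" by (intro finite_measure_mono) auto
    then have "V (t * x) / V x \<le> measure D {t * x..} / V x"
      by (rule divide_right_mono) simp
    then show ?case using elim by linarith
  qed
next
  fix y assume y: "t powr - \<alpha> < y"
  have "((\<lambda>s. s powr - \<alpha>) \<longlongrightarrow> t powr - \<alpha>) (at_left t)"
    using t by (intro tendsto_intros) auto
  then have "\<forall>\<^sub>F s in at_left t. s powr - \<alpha> < y" by (rule order_tendstoD(2)[OF _ y])
  moreover have "\<forall>\<^sub>F s in at_left t. s > 0" by (rule eventually_at_leftI[of 0]) (use t in auto)
  moreover have "\<forall>\<^sub>F s in at_left t. s < t" by (auto simp: eventually_at_filter)
  ultimately have "\<forall>\<^sub>F s in at_left t. s powr - \<alpha> < y \<and> s > 0 \<and> s < t"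
    by eventually_elim auto
  then obtain s where s: "s powr - \<alpha> < y" "s > 0" "s < t"
    using eventually_happens'[of "at_left t"] by (auto simp: trivial_limit_at_left_real)
  have "\<forall>\<^sub>F x in at_top. V (s * x) / V x < y"
    by (rule order_tendstoD(2)[OF tail_regular[OF s(2)] s(1)])
  then show "\<forall>\<^sub>F x in at_top. measure D {t * x..} / V x < y"
    using eventually_gt_at_top[of 0]
  proof eventually_elim
    case (elim x)
    have "measure D {t * x..} \<le> V (s * x)"
      using mult_strict_right_mono[OF s(3) elim(2)] by (intro finite_measure_mono) auto
    then have "measure D {t * x..} / V x \<le> V (s * x) / V x"
      by (rule divide_right_mono) simp
    then show ?case using elim by linarith
  qed
qed

lemma measure_greaterThanAtMost: "u \<le> v \<Longrightarrow> measure D {u<..v} = V u - V v"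
proof -
  assume "u \<le> v"
  then have "{u<..v} = {u<..} - {v<..}" by auto
  moreover have "measure D ({u<..} - {v<..}) = V u - V v"
    using \<open>u \<le> v\<close> by (intro finite_measure_Diff) auto
  ultimately show ?thesis by simp
qed

lemma measure_greaterThanLessThan: "u < v \<Longrightarrow> measure D {u<..<v} = V u - measure D {v..}"
proof -
  assume "u < v"
  then have "{u<..<v} = {u<..} - {v..}" by auto
  moreover have "measure D ({u<..} - {v..}) = V u - measure D {v..}"
    using \<open>u < v\<close> by (intro finite_measure_Diff) auto
  ultimately show ?thesis by simp
qed

end

section \<open>The scaling limit of the claim law on a window of order \<open>x\<close>\<close>

locale heavy_tail_window = heavy_tail +
  fixes e a :: real
  assumes e_pos: "0 < e" and e_less: "e < a"
begin

abbreviation W :: "real \<Rightarrow> real set" where "W x \<equiv> {e * x<..<a * x}"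

definition window_mass :: real where "window_mass = e powr - \<alpha> - a powr - \<alpha>"

lemma window_mass_pos: "window_mass > 0"
  using e_pos e_less alpha_pos by (simp add: window_mass_def powr_less_mono2_neg)

lemma window_limit: "((\<lambda>x. measure D (W x) / V x) \<longlongrightarrow> window_mass) at_top"
proof -
  have "((\<lambda>x. V (e * x) / V x - measure D {a * x..} / V x) \<longlongrightarrow> window_mass) at_top"
    unfolding window_mass_def using e_pos e_less by (intro tendsto_intros tail_regular tail_closed_limit) auto
  moreover have "\<forall>\<^sub>F x in at_top. V (e * x) / V x - measure D {a * x..} / V x = measure D (W x) / V x"
    using eventually_gt_at_top[of 0]
  proof eventually_elim
    case (elim x)
    then show ?case using e_less
      by (subst measure_greaterThanLessThan) (auto simp: diff_divide_distrib)
  qed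
  ultimately show ?thesis by (rule Lim_transform_eventually)
qed

lemma window_pos: "\<forall>\<^sub>F x in at_top. measure D (W x) > 0"
  using order_tendstoD(1)[OF window_limit window_mass_pos]
  by eventually_elim (use tail_pos in \<open>auto simp: zero_less_divide_iff not_less[symmetric]\<close>)

text \<open>The conditional law of \<open>z / x\<close> given that \<open>z\<close> lies in the
  window. Skorohod's representation is about probability measures, so the law is normalised and the
  mass of the window is carried as a separate factor.\<close>

definition Q :: "real \<Rightarrow> real measure" where
  "Q x = distr (uniform_measure D (W x)) borel (\<lambda>z. z / x)"

text \<open>Clamping \<open>z\<close> to \<open>[e, a]\<close> lets one formula serve on the whole
  line.\<close>

definition limit_cdf :: "real \<Rightarrow> real" where
  "limit_cdf z = (e powr - \<alpha> - (max e (min a z)) powr - \<alpha>) / window_mass"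

definition Q_limit :: "real measure" where "Q_limit = interval_measure limit_cdf"

lemma limit_cdf_mono: "x \<le> y \<Longrightarrow> limit_cdf x \<le> limit_cdf y"
  unfolding limit_cdf_def using window_mass_pos e_pos alpha_pos
  by (intro divide_right_mono diff_left_mono powr_mono2') auto

lemma limit_cdf_right_cont: "continuous (at_right z) limit_cdf"
proof -
  have "max e (min a z) \<noteq> 0" "window_mass \<noteq> 0" using e_pos window_mass_pos by auto
  then have "(limit_cdf \<longlongrightarrow> limit_cdf z) (at_right z)"
    unfolding limit_cdf_def by (intro tendsto_intros) auto
  then show ?thesis by (simp add: continuous_within)
qed

lemma limit_cdf_below: "z \<le> e \<Longrightarrow> limit_cdf z = 0"
  using e_less by (simp add: limit_cdf_def max_absorb1)

lemma limit_cdf_above: "z \<ge> a \<Longrightarrow> limit_cdf z = 1"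
  using e_less window_mass_pos by (simp add: limit_cdf_def max_absorb2 window_mass_def)

lemma limit_cdf_at_bot: "(limit_cdf \<longlongrightarrow> 0) at_bot"
  using limit_cdf_below by (intro tendsto_eventually eventually_mono[OF eventually_le_at_bot[of e]])

lemma limit_cdf_at_top: "(limit_cdf \<longlongrightarrow> 1) at_top"
  using limit_cdf_above by (intro tendsto_eventually eventually_mono[OF eventually_ge_at_top[of a]])

lemma real_distribution_Q_limit: "real_distribution Q_limit"
  unfolding Q_limit_def
  by (intro real_distribution_interval_measure limit_cdf_mono limit_cdf_right_cont limit_cdf_at_bot limit_cdf_at_top)

lemma cdf_Q_limit: "cdf Q_limit = limit_cdf"
  unfolding Q_limit_def
  by (intro cdf_interval_measure limit_cdf_mono limit_cdf_right_cont limit_cdf_at_bot)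

text \<open>The limiting law charges every left neighbourhood of \<open>a\<close>; this is the
  source of positivity of the final constant.\<close>

lemma Q_limit_greater_pos:
  assumes "l < a"
  shows "measure Q_limit {l<..a} > 0"
proof -
  interpret Ql: real_distribution Q_limit by (rule real_distribution_Q_limit)
  define l' where "l' = max l e"
  have l': "e \<le> l'" "l' < a" using assms e_less by (auto simp: l'_def)
  have "measure Q_limit {l'<..a} = limit_cdf a - limit_cdf l'"
    using l' Ql.cdf_diff_eq[of l' a] by (simp add: cdf_Q_limit)
  moreover have "limit_cdf l' < limit_cdf a"
    unfolding limit_cdf_def using window_mass_pos l' e_pos alpha_pos
    by (intro divide_strict_right_mono diff_strict_left_mono powr_less_mono2_neg) auto
  ultimately have "0 < measure Q_limit {l'<..a}" by simp
  also have "\<dots> \<le> measure Q_limit {l<..a}"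
    by (intro Ql.finite_measure_mono) (auto simp: l'_def)
  finally show ?thesis .
qed

lemma real_distribution_Q:
  assumes "measure D (W x) > 0"
  shows "real_distribution (Q x)"
proof -
  interpret U: prob_space "uniform_measure D (W x)"
    using assms by (intro prob_space_uniform_measure) (auto simp: emeasure_eq_measure)
  show ?thesis unfolding Q_def
    by (intro U.real_distribution_distr) simp
qed

lemma AE_Q:
  assumes "measure D (W x) > 0" "x > 0"
  shows "AE w in Q x. w \<le> a"
proof -
  have "AE z in uniform_measure D (W x). z / x \<le> a"
    using assms by (intro AE_uniform_measureI) (auto simp: field_simps)
  then show ?thesis unfolding Q_def by (subst AE_distr_iff) auto
qed

lemma cdf_Q:
  assumes "measure D (W x) > 0" "x > 0"
  shows "cdf (Q x) z = measure D (W x \<inter> {..z * x}) / measure D (W x)"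
proof -
  have "(\<lambda>z. z / x) -` {..z} \<inter> space (uniform_measure D (W x)) = {..z * x}"
    using assms by (auto simp: field_simps)
  then show ?thesis unfolding cdf_def Q_def using assms
    by (subst measure_distr) (auto simp: measure_uniform_measure emeasure_eq_measure)
qed

text \<open>Inside the window the distribution function is a quotient of differences of tails, each
  asymptotic to a multiple of \<open>V x\<close>; at or beyond the end points it is eventually
  exactly 0 or 1.\<close>

lemma cdf_Q_limit_at_top: "((\<lambda>x. cdf (Q x) z) \<longlongrightarrow> limit_cdf z) at_top"
proof -
  have ev: "\<forall>\<^sub>F x in at_top. cdf (Q x) z = measure D (W x \<inter> {..z * x}) / measure D (W x) \<and> x > 0 \<and> measure D (W x) > 0"
    using window_pos eventually_gt_at_top[of 0] by eventually_elim (auto intro: cdf_Q)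
  consider "z \<le> e" | "e < z" "z < a" | "z \<ge> a" by linarith
  then show ?thesis
  proof cases
    case 1
    have "\<forall>\<^sub>F x in at_top. cdf (Q x) z = limit_cdf z"
      using ev
    proof eventually_elim
      case (elim x)
      then have "z * x \<le> e * x" using 1 by (simp add: mult_right_mono)
      then have "W x \<inter> {..z * x} = {}" by auto
      then show ?case using elim limit_cdf_below[OF 1] by simp
    qed
    then show ?thesis by (rule tendsto_eventually)
  next
    case 3
    have "\<forall>\<^sub>F x in at_top. cdf (Q x) z = limit_cdf z"
      using ev
    proof eventually_elim
      case (elim x)
      then have "a * x \<le> z * x" using 3 by (simp add: mult_right_mono)
      then have "W x \<inter> {..z * x} = W x" by auto
      then show ?case using elim limit_cdf_above[OF 3] by simp
    qed
    then show ?thesis by (rule tendsto_eventually)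
  next
    case 2
    have "((\<lambda>x. (V (e * x) / V x - V (z * x) / V x) / (measure D (W x) / V x)) \<longlongrightarrow> (e powr - \<alpha> - z powr - \<alpha>) / window_mass) at_top"
      using e_pos 2 window_mass_pos by (intro tendsto_intros tail_regular window_limit) auto
    moreover have "\<forall>\<^sub>F x in at_top. (V (e * x) / V x - V (z * x) / V x) / (measure D (W x) / V x) = cdf (Q x) z"
      using ev
    proof eventually_elim
      case (elim x)
      have "z * x < a * x" using 2 elim by simp
      then have "W x \<inter> {..z * x} = {e * x<..z * x}" by auto
      moreover have "measure D {e * x<..z * x} = V (e * x) - V (z * x)"
        using 2 elim by (intro measure_greaterThanAtMost) auto
      ultimately show ?case using elim tail_pos[of x] by (simp add: diff_divide_distrib[symmetric])
    qed
    ultimately show ?thesis using 2 by (simp add: limit_cdf_def Lim_transform_eventually)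
  qed
qed

text \<open>The limit of \<open>smear D (W x)\<close> divided by \<open>V x\<close>, with arguments
  measured in units of \<open>x\<close>.\<close>

definition limit_smear :: "(real \<Rightarrow> real) \<Rightarrow> real \<Rightarrow> real" where
  "limit_smear G u = window_mass * (\<integral>w. G (u - w) \<partial>Q_limit)"

lemma smear_window:
  assumes "measure D (W x) > 0" "x > 0" and [measurable]: "\<phi> \<in> borel_measurable borel"
  shows "smear D (W x) \<phi> (h * x) = measure D (W x) * (\<integral>w. \<phi> ((h - w) * x) \<partial>Q x)"
proof -
  have "(\<integral>w. \<phi> ((h - w) * x) \<partial>Q x) = (\<integral>z. \<phi> (h * x - z) \<partial>uniform_measure D (W x))"
    unfolding Q_def using assms(2) by (subst integral_distr) (auto simp: algebra_simps)
  also have "uniform_measure D (W x) = density D (\<lambda>z. ennreal (indicator (W x) z / measure D (W x)))"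
    unfolding uniform_measure_def
  proof (intro density_cong AE_I2)
    show "indicator (W x) z / emeasure D (W x) = ennreal (indicator (W x) z / measure D (W x))" for z
      using divide_ennreal[of 1 "measure D (W x)"] assms(1)
      by (cases "z \<in> W x") (simp_all add: emeasure_eq_measure)
  qed auto
  also have "(\<integral>z. \<phi> (h * x - z) \<partial>\<dots>) = (\<integral>z. (indicator (W x) z / measure D (W x)) * \<phi> (h * x - z) \<partial>D)"
    by (subst integral_density) auto
  also have "\<dots> = smear D (W x) \<phi> (h * x) / measure D (W x)"
    unfolding smear_def by (subst integral_divide_zero[symmetric]) (simp add: field_simps)
  finally show ?thesis using assms(1) by simp
qed

text \<open>Each convolution contributes one factor \<open>V\<close>, by the limit of the window
  mass, and preserves continuous convergence, by the weak convergence of the normalised laws. The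
  starting function may depend on \<open>n\<close> because the rescaled count does.\<close>

lemma smear_funpow_limit:
  assumes X: "filterlim X at_top sequentially" "\<And>n. X n > 0" "\<And>n. measure D (W (X n)) > 0"
    and \<phi>: "\<And>n. antimono_nonneg (\<phi> n)" "continuously_converges (\<lambda>n h. \<phi> n (h * X n)) G"
  shows "continuously_converges
    (\<lambda>n h. (smear D (W (X n)) ^^ j) (\<phi> n) (h * X n) / V (X n) ^ j) ((limit_smear ^^ j) G)"
proof (induction j)
  case (Suc j)
  define \<psi> where "\<psi> n = (smear D (W (X n)) ^^ j) (\<phi> n)" for n
  have an: "antimono_nonneg (\<psi> n)" for n
    unfolding \<psi>_def
    by (rule antimono_nonneg_smear_funpow[where b = "a * X n"]) (use \<phi> finite_measure_axioms in auto)
  define F where "F n h = \<psi> n (h * X n) / V (X n) ^ j" for n h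
  have F: "antimono_nonneg (F n)" for n
    using antimono_nonnegD[OF an[of n]] X(2)[of n]
    by (auto simp: F_def antimono_nonneg_def antimono_def intro!: divide_right_mono mult_right_mono)
  have "continuously_converges (\<lambda>n u. \<integral>w. F n (u - w) \<partial>Q (X n)) (\<lambda>u. \<integral>w. (limit_smear ^^ j) G (u - w) \<partial>Q_limit)"
  proof (rule continuously_converges_convolution[where b = a, OF _ _ _ _ F])
    show "weak_conv_m (\<lambda>n. Q (X n)) Q_limit"
      unfolding weak_conv_m_def weak_conv_def cdf_Q_limit
      by (auto intro: filterlim_compose[OF cdf_Q_limit_at_top X(1)])
    show "continuously_converges F ((limit_smear ^^ j) G)"
      using Suc unfolding F_def \<psi>_def by simp
  qed (use X in \<open>auto intro: real_distribution_Q real_distribution_Q_limit AE_Q\<close>)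
  moreover have "(\<lambda>n. measure D (W (X n)) / V (X n)) \<longlonglongrightarrow> window_mass"
    by (rule filterlim_compose[OF window_limit X(1)])
  ultimately have *: "continuously_converges (\<lambda>n u. (measure D (W (X n)) / V (X n)) * (\<integral>w. F n (u - w) \<partial>Q (X n))) (limit_smear ((limit_smear ^^ j) G))"
    unfolding continuously_converges_def limit_smear_def[of "(limit_smear ^^ j) G"]
    by (intro allI impI tendsto_mult) auto
  have "(measure D (W (X n)) / V (X n)) * (\<integral>w. F n (u - w) \<partial>Q (X n))
      = (smear D (W (X n)) ^^ Suc j) (\<phi> n) (u * X n) / V (X n) ^ Suc j" for n u
    using smear_window[OF X(3)[of n] X(2)[of n] antimono_nonnegD(3)[OF an[of n]], of u]
    by (simp add: F_def \<psi>_def[symmetric])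
  with * show ?case by simp
qed (use \<phi> in simp)

text \<open>\<^term>\<open>Q_limit\<close> has density \<open>\<alpha> z powr (- \<alpha> - 1) / window_mass\<close> on \<open>(e, a)\<close>, so \<open>\<Gamma> k h\<close> is the integral of
  \<open>max 0 (z\<^sub>1 + \<dots> + z\<^sub>k - h) ^ k / k!\<close> against the product of the measures \<open>\<alpha> z powr (- \<alpha> - 1) dz\<close>.\<close>
definition \<Gamma> :: "nat \<Rightarrow> real \<Rightarrow> real" where
  "\<Gamma> k = (limit_smear ^^ k) (\<lambda>h. max 0 (- h) ^ k / fact k)"

lemma limit_smear_funpow_divide: "(limit_smear ^^ j) (\<lambda>h. G h / c) = (\<lambda>h. (limit_smear ^^ j) G h / c)"
  by (induction j) (auto simp: limit_smear_def)

lemma subset_count_smear_limit: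
  assumes "c > 0" "k > 0"
  shows "((\<lambda>x. (smear D (W x) ^^ k) (subset_count k c) (h * x) / (x * V x) ^ k) \<longlongrightarrow> \<Gamma> k h / c ^ k) at_top"
proof -
  let ?f = "\<lambda>x. (smear D (W x) ^^ k) (subset_count k c) (h * x) / (x * V x) ^ k"
  obtain x0 where x0: "\<And>x. x \<ge> x0 \<Longrightarrow> measure D (W x) > 0 \<and> x > 0"
    using eventually_conj[OF window_pos eventually_gt_at_top[of 0]]
    by (auto simp: eventually_at_top_linorder)
  \<comment> \<open>The sequential results require positivity at every index, so the argument is
    clamped below by \<open>x0\<close>, which changes nothing near infinity.\<close>
  have "((\<lambda>x. ?f (max x0 x)) \<longlongrightarrow> \<Gamma> k h / c ^ k) at_top"
  proof (rule tendsto_at_topI_sequentially)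
    fix Y :: "nat \<Rightarrow> real"
    assume Y: "filterlim Y at_top sequentially"
    define X where "X n = max x0 (Y n)" for n
    have X: "filterlim X at_top sequentially"
      by (rule filterlim_at_top_mono[OF Y]) (simp add: X_def)
    have X0: "X n > 0" "measure D (W (X n)) > 0" for n using x0[of "X n"] by (auto simp: X_def)
    have "continuously_converges (\<lambda>n u. subset_count k c (u * X n) / X n ^ k) (\<lambda>u. max 0 (- u / c) ^ k / fact k)"
      by (rule subset_count_limit[OF assms X X0(1)])
    moreover have "antimono_nonneg (\<lambda>u. subset_count k c u / X n ^ k)" for n
      using antimono_nonnegD[OF antimono_nonneg_subset_count[OF assms(1), of k]] X0(1)[of n]
      by (auto simp: antimono_nonneg_def antimono_def intro!: divide_right_mono)
    ultimately have "continuously_converges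
      (\<lambda>n u. (smear D (W (X n)) ^^ k) (\<lambda>u. subset_count k c u / X n ^ k) (u * X n) / V (X n) ^ k)
      ((limit_smear ^^ k) (\<lambda>u. max 0 (- u / c) ^ k / fact k))"
      by (intro smear_funpow_limit X X0) auto
    from continuously_convergesD[OF this tendsto_const]
    have "(\<lambda>n. (smear D (W (X n)) ^^ k) (\<lambda>u. subset_count k c u / X n ^ k) (h * X n) / V (X n) ^ k)
      \<longlonglongrightarrow> (limit_smear ^^ k) (\<lambda>u. max 0 (- u / c) ^ k / fact k) h" .
    moreover have "max 0 (- u / c) ^ k / fact k = max 0 (- u) ^ k / fact k / c ^ k" for u
    proof -
      have "max 0 (- u / c) = max 0 (- u) / c"
        using assms(1) by (simp add: max_def divide_le_0_iff)
      then show ?thesis by (simp add: power_divide)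
    qed
    moreover have "(smear D A ^^ j) (\<lambda>u. \<phi> u / d) = (\<lambda>u. (smear D A ^^ j) \<phi> u / d)" for A \<phi> d j
      by (induction j) (auto simp: smear_def)
    ultimately have "(\<lambda>n. (smear D (W (X n)) ^^ k) (subset_count k c) (h * X n) / X n ^ k / V (X n) ^ k) \<longlonglongrightarrow> \<Gamma> k h / c ^ k"
      by (simp only: limit_smear_funpow_divide[of k "\<lambda>u. max 0 (- u) ^ k / fact k" "c ^ k"] \<Gamma>_def)
    then show "(\<lambda>n. ?f (max x0 (Y n))) \<longlonglongrightarrow> \<Gamma> k h / c ^ k"
      by (simp add: X_def power_mult_distrib)
  qed
  then show ?thesis
    by (rule Lim_transform_eventually)
       (auto simp: eventually_at_top_linorder max_def intro!: exI[of _ x0])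
qed

lemma AE_Q_limit: "AE w in Q_limit. w \<le> a"
proof -
  interpret Ql: real_distribution Q_limit by (rule real_distribution_Q_limit)
  have "measure Q_limit {..a} = 1" using limit_cdf_above[of a] by (simp flip: cdf_Q_limit add: cdf_def)
  then show ?thesis by (subst (asm) Ql.prob_eq_1) auto
qed

lemma integrable_Q_limit:
  assumes "antimono_nonneg G"
  shows "integrable Q_limit (\<lambda>w. G (u - w))"
proof -
  interpret Ql: real_distribution Q_limit by (rule real_distribution_Q_limit)
  note [measurable] = antimono_nonnegD(3)[OF assms]
  have "AE w in Q_limit. norm (G (u - w)) \<le> G (u - a)"
    using AE_Q_limit
  proof eventually_elim
    case (elim w)
    then show ?case using antimono_nonnegD(1)[OF assms, of "u - a" "u - w"] antimono_nonnegD(2)[OF assms] by auto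
  qed
  then show ?thesis by (rule Ql.integrable_const_bound) measurable
qed

lemma antimono_nonneg_limit_smear:
  assumes "antimono_nonneg G"
  shows "antimono_nonneg (limit_smear G)"
  unfolding antimono_nonneg_def antimono_def limit_smear_def
  using window_mass_pos antimono_nonnegD[OF assms]
  by (auto intro!: mult_left_mono integral_mono integrable_Q_limit[OF assms] mult_nonneg_nonneg)

text \<open>Continuity is continuous convergence of a constant sequence, so the convolution theorem
  applies with constant laws.\<close>

lemma limit_smear_continuous:
  assumes "antimono_nonneg G" "continuously_converges (\<lambda>_. G) G"
  shows "continuously_converges (\<lambda>_. limit_smear G) (limit_smear G)"
proof -
  have "weak_conv_m (\<lambda>_. Q_limit) Q_limit" by (simp add: weak_conv_m_def weak_conv_def)
  then have "continuously_converges (\<lambda>_ u. \<integral>w. G (u - w) \<partial>Q_limit) (\<lambda>u. \<integral>w. G (u - w) \<partial>Q_limit)"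
    by (intro continuously_converges_convolution[where b = a] real_distribution_Q_limit AE_Q_limit assms)
  then show ?thesis
    unfolding continuously_converges_def limit_smear_def[of G] by (auto intro!: tendsto_mult)
qed

lemma antimono_nonneg_base: "antimono_nonneg (\<lambda>h. max 0 (- h) ^ k / fact k)"
  by (auto simp: antimono_nonneg_def antimono_def intro!: divide_right_mono power_mono)

lemma limit_smear_funpow_base:
  fixes k :: nat
  defines "G \<equiv> \<lambda>h. max 0 (- h) ^ k / fact k"
  shows "antimono_nonneg ((limit_smear ^^ j) G)" "continuously_converges (\<lambda>_. (limit_smear ^^ j) G) ((limit_smear ^^ j) G)"
proof -
  have "antimono_nonneg ((limit_smear ^^ j) G) \<and> continuously_converges (\<lambda>_. (limit_smear ^^ j) G) ((limit_smear ^^ j) G)"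
  proof (induction j)
    case 0
    have "continuously_converges (\<lambda>_. G) G"
      unfolding continuously_converges_def G_def
      by (intro allI impI tendsto_divide tendsto_power tendsto_max tendsto_minus tendsto_const) auto
    then show ?case using antimono_nonneg_base by (simp add: G_def)
  next
    case (Suc j)
    then show ?case using antimono_nonneg_limit_smear limit_smear_continuous by simp
  qed
  then show "antimono_nonneg ((limit_smear ^^ j) G)" "continuously_converges (\<lambda>_. (limit_smear ^^ j) G) ((limit_smear ^^ j) G)"
    by auto
qed

lemma isCont_Gamma: "isCont (\<Gamma> k) h"
  unfolding \<Gamma>_def
  by (rule continuous_at_sequentiallyI) (rule continuously_convergesD[OF limit_smear_funpow_base(2)])

text \<open>If \<open>h < k * a\<close>, then \<open>k\<close> scaled claims close enough to
  \<open>a\<close> sum to more than \<open>h\<close>, and such claims carry positive mass.\<close>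

lemma Gamma_pos:
  assumes "h < real k * a"
  shows "\<Gamma> k h > 0"
proof -
  let ?G = "\<lambda>h :: real. max 0 (- h) ^ k / fact k"
  interpret Ql: real_distribution Q_limit by (rule real_distribution_Q_limit)
  have "(limit_smear ^^ j) ?G h > 0" if "h < real j * a" for j h
    using that
  proof (induction j arbitrary: h)
    case (Suc j)
    \<comment> \<open>The midpoint of \<open>h - j * a\<close> and \<open>a\<close>: a claim above
      \<open>l\<close> leaves a level below \<open>j * a\<close>, as the induction hypothesis
      requires.\<close>
    define l where "l = (h - j * a + a) / 2"
    have l: "l < a" "h - l < j * a" using Suc.prems by (auto simp: l_def field_simps)
    define F where "F = (limit_smear ^^ j) ?G"
    have F: "antimono_nonneg F" unfolding F_def by (rule limit_smear_funpow_base(1))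
    have "0 < F (h - l) * measure Q_limit {l<..a}"
      unfolding F_def by (intro mult_pos_pos Suc.IH l Q_limit_greater_pos)
    also have "\<dots> = (\<integral>w. F (h - l) * indicator {l<..a} w \<partial>Q_limit)" by simp
    also have "\<dots> \<le> (\<integral>w. F (h - w) \<partial>Q_limit)"
    proof (intro integral_mono integrable_Q_limit[OF F])
      show "integrable Q_limit (\<lambda>w. F (h - l) * indicator {l<..a} w)"
        by (intro integrable_mult_right integrable_real_indicator) (auto simp: less_top[symmetric])
      show "F (h - l) * indicator {l<..a} w \<le> F (h - w)" for w
        using antimono_nonnegD[OF F] by (auto simp: indicator_def)
    qed
    finally show ?case using window_mass_pos by (simp add: limit_smear_def[of F] flip: F_def)
  qed (auto simp: zero_less_power)
  with assms show ?thesis by (simp add: \<Gamma>_def)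
qed

end


section \<open>Power bounds, moments and exponential moments of truncated claims\<close>

definition trunc :: "real \<Rightarrow> real \<Rightarrow> real" where "trunc y z = (if z \<le> y then z else 0)"

lemma trunc_measurable [measurable]: "trunc y \<in> borel_measurable borel"
  unfolding trunc_def by measurable

context heavy_tail
begin

text \<open>A one-sided Potter bound: eventually, doubling the argument costs at most the factor
  \<open>2 powr - \<gamma>\<close>, and this is iterated. It turns any error of sufficiently high
  negative power order into an error negligible against \<open>(x * V x) ^ k\<close>.\<close>

lemma tail_power_lower_bound:
  assumes "\<gamma> > \<alpha>"
  obtains c where "c > 0" "\<forall>\<^sub>F x in at_top. V x \<ge> c * x powr - \<gamma>"
proof -
  have "(2::real) powr - \<gamma> < 2 powr - \<alpha>" using assms by simp
  from order_tendstoD(1)[OF tail_regular[of 2] this]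
  obtain X0 where X0: "\<And>x. x \<ge> X0 \<Longrightarrow> 2 powr - \<gamma> < V (2 * x) / V x"
    by (auto simp: eventually_at_top_linorder)
  define X where "X = max 1 X0"
  have X: "X > 0" by (simp add: X_def)
  have double: "V (2 * x) \<ge> 2 powr - \<gamma> * V x" if "x \<ge> X" for x
    using X0[of x] that tail_pos[of x] by (simp add: X_def field_simps)
  \<comment> \<open>Chosen so that monotonicity alone gives the bound on \<open>[X, 2 * X]\<close>,
    where the doubling starts.\<close>
  define c where "c = V (2 * X) * X powr \<gamma>"
  have c: "c > 0" using X tail_pos by (simp add: c_def)
  have \<gamma>: "\<gamma> > 0" using assms alpha_pos by simp
  have bound: "V x \<ge> c * x powr - \<gamma>" if "X \<le> x" "x \<le> 2 ^ j * X" for x j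
    using that
  proof (induction j arbitrary: x)
    case 0
    then have "x = X" by simp
    then show ?case using X V_antimono[of X "2 * X"] by (simp add: c_def powr_minus field_simps)
  next
    case (Suc j)
    show ?case
    proof (cases "x \<le> 2 * X")
      case True
      have "x powr - \<gamma> \<le> X powr - \<gamma>" using Suc.prems X \<gamma> by (intro powr_mono2') auto
      then have "c * x powr - \<gamma> \<le> c * X powr - \<gamma>" using c by simp
      also have "\<dots> = V (2 * X)" using X by (simp add: c_def powr_minus)
      also have "\<dots> \<le> V x" using True by (rule V_antimono)
      finally show ?thesis .
    next
      case False
      have x: "x > 0" using X Suc.prems by linarith
      have "c * x powr - \<gamma> = 2 powr - \<gamma> * (c * (x / 2) powr - \<gamma>)"
        using x by (simp add: powr_divide)
      also have "\<dots> \<le> 2 powr - \<gamma> * V (x / 2)"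
        using False Suc.prems by (intro mult_left_mono Suc.IH) auto
      also have "\<dots> \<le> V x" using double[of "x / 2"] False by simp
      finally show ?thesis .
    qed
  qed
  have "V x \<ge> c * x powr - \<gamma>" if "x \<ge> X" for x
  proof -
    obtain j where "x / X < 2 ^ j" using real_arch_pow[of 2 "x / X"] by auto
    then show ?thesis using that X by (intro bound[of x j]) (auto simp: field_simps)
  qed
  then have "\<forall>\<^sub>F x in at_top. V x \<ge> c * x powr - \<gamma>"
    by (auto simp: eventually_at_top_linorder)
  with c show thesis by (rule that)
qed

text \<open>On the dyadic shell from \<open>2 ^ j\<close> to \<open>2 ^ Suc j\<close> the integrand
  is at most \<open>(2 ^ Suc j) powr p\<close>. The resulting series converges by the ratio test,
  its ratios tending to \<open>2 powr (p - \<alpha>) < 1\<close>.\<close>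

lemma integrable_power_moment:
  assumes p: "0 \<le> p" "p < \<alpha>"
  shows "integrable D (\<lambda>z. indicator {1<..} z * z powr p)"
proof -
  define f where "f j = (2 ^ Suc j) powr p * V (2 ^ j)" for j :: nat
  have f_nonneg: "f j \<ge> 0" for j by (simp add: f_def)
  have "(\<lambda>j. V (2 * 2 ^ j) / V (2 ^ j)) \<longlonglongrightarrow> 2 powr - \<alpha>"
  proof (rule filterlim_compose[OF tail_regular])
    show "filterlim (\<lambda>j :: nat. (2 :: real) ^ j) at_top sequentially" by real_asymp
  qed simp
  moreover obtain r where r: "2 powr - \<alpha> < r" "r < 2 powr - p"
    using dense[of "2 powr - \<alpha>" "2 powr - p :: real"] p by auto
  ultimately have "\<forall>\<^sub>F j in sequentially. V (2 * 2 ^ j) / V (2 ^ j) < r"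
    by (intro order_tendstoD)
  then obtain N where N: "\<And>j. j \<ge> N \<Longrightarrow> V (2 * 2 ^ j) / V (2 ^ j) < r"
    by (auto simp: eventually_sequentially)
  have "summable f"
  proof (rule summable_ratio_test)
    show "2 powr p * r < 1" using r by (simp add: powr_minus field_simps)
    fix j assume "N \<le> j"
    then have "V (2 * 2 ^ j) \<le> r * V (2 ^ j)" using N[of j] tail_pos[of "2 ^ j"] by (simp add: field_simps)
    then have "(2 ^ Suc (Suc j)) powr p * V (2 * 2 ^ j) \<le> (2 ^ Suc (Suc j)) powr p * (r * V (2 ^ j))"
      by (intro mult_left_mono) auto
    also have "\<dots> = 2 powr p * r * f j"
      using powr_mult[of 2 2 p] by (simp add: f_def powr_mult)
    finally show "norm (f (Suc j)) \<le> 2 powr p * r * norm (f j)"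
      by (simp add: f_def)
  qed
  have pw: "ennreal (indicator {1<..} z * z powr p) \<le> (\<Sum>j. ennreal ((2 ^ Suc j) powr p) * indicator {2 ^ j<..} z)" for z
  proof (cases "z > 1")
    case True
    obtain n where n: "z < 2 ^ n" using real_arch_pow[of 2 z] by auto
    define k where "k = (LEAST n. z \<le> 2 ^ n)"
    have k: "z \<le> 2 ^ k" unfolding k_def by (rule LeastI[of _ n]) (use n in simp)
    then obtain j where j: "k = Suc j" using True by (cases k) auto
    have "\<not> z \<le> 2 ^ j" using not_less_Least[of j "\<lambda>n. z \<le> 2 ^ n"] j by (simp add: k_def)
    then have "ennreal (indicator {1<..} z * z powr p) \<le> ennreal ((2 ^ Suc j) powr p) * indicator {2 ^ j<..} z"
      using k j True p by (auto intro!: ennreal_leI powr_mono2)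
    also have "\<dots> \<le> (\<Sum>j. ennreal ((2 ^ Suc j) powr p) * indicator {2 ^ j<..} z)"
    proof -
      have "g j \<le> suminf g" for g :: "nat \<Rightarrow> ennreal"
        using sum_le_suminf[of g "{j}"] by (simp add: summableI)
      then show ?thesis .
    qed
    finally show ?thesis .
  qed auto
  have "(\<integral>\<^sup>+z. ennreal (indicator {1<..} z * z powr p) \<partial>D)
      \<le> (\<integral>\<^sup>+z. (\<Sum>j. ennreal ((2 ^ Suc j) powr p) * indicator {2 ^ j<..} z) \<partial>D)"
    by (intro nn_integral_mono pw)
  also have "\<dots> = (\<Sum>j. ennreal (f j))"
    by (subst nn_integral_suminf) (auto simp: f_def nn_integral_cmult_indicator emeasure_eq_measure ennreal_mult)
  also have "\<dots> < \<infinity>"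
    using \<open>summable f\<close> f_nonneg by (simp add: suminf_ennreal2)
  finally show ?thesis
    by (intro integrableI_nonneg) auto
qed

text \<open>With \<open>s = q * ln x / x\<close>, claims up to \<open>sqrt x\<close> have
  \<open>exp (s * z)\<close> close to 1 and produce the mean. For claims between
  \<open>sqrt x\<close> and \<open>\<epsilon> * x\<close> the exponential is at most
  \<open>x powr (\<beta> / 4)\<close>, while a finite moment of order \<open>1 + \<beta>\<close>
  gains \<open>x powr (- \<beta> / 2)\<close>, so their contribution vanishes relative to
  \<open>s\<close>.\<close>

lemma truncated_exp_moment:
  assumes alpha: "\<alpha> > 1" and nonneg: "AE z in D. 0 \<le> z" and int: "integrable D (\<lambda>z. z)"
    and q: "q > 0" and \<delta>: "\<delta> > 0"
  obtains \<epsilon> where "\<epsilon> > 0"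
    "\<forall>\<^sub>F x in at_top. (\<integral>z. exp (q * ln x / x * trunc (\<epsilon> * x) z) \<partial>D) \<le> 1 + q * ln x / x * ((\<integral>z. z \<partial>D) + \<delta>)"
proof -
  define \<beta> where "\<beta> = (\<alpha> - 1) / 2"
  have \<beta>: "\<beta> > 0" "1 + \<beta> < \<alpha>" using alpha by (auto simp: \<beta>_def field_simps)
  \<comment> \<open>This makes \<open>s * (\<epsilon> * x) = \<beta> / 4 * ln x\<close>, half of the
    power gained from the moment.\<close>
  define \<epsilon> where "\<epsilon> = \<beta> / (4 * q)"
  have \<epsilon>: "\<epsilon> > 0" using \<beta> q by (simp add: \<epsilon>_def)
  define f :: "real \<Rightarrow> real" where "f z = indicator {1<..} z * z powr (1 + \<beta>)" for z
  have f: "integrable D f" unfolding f_def by (rule integrable_power_moment) (use \<beta> in auto)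
  define \<mu> where "\<mu> = (\<integral>z. z \<partial>D)"
  define R where "R = (\<integral>z. f z \<partial>D)"
  have pointwise: "exp (s * trunc (\<epsilon> * x) z) \<le> 1 + s * (exp (s * sqrt x) * z + x powr (- \<beta> / 4) * f z)"
    if "s = q * ln x / x" "x > 1" "z \<ge> 0" for s x z
  proof -
    have s: "s \<ge> 0" using that q by simp
    define t where "t = trunc (\<epsilon> * x) z"
    have t: "0 \<le> t" "t \<le> z" using that by (auto simp: t_def trunc_def)
    \<comment> \<open>Multiplying by \<open>exp (s * t)\<close> yields
      \<open>exp (s * t) \<le> 1 + s * t * exp (s * t)\<close>, which keeps the constant term
      exactly 1.\<close>
    have "1 - s * t \<le> exp (- (s * t))" using exp_ge_add_one_self[of "- (s * t)"] by simp
    then have "(1 - s * t) * exp (s * t) \<le> exp (- (s * t)) * exp (s * t)" by (intro mult_right_mono) auto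
    then have "exp (s * t) \<le> 1 + s * (t * exp (s * t))" by (simp add: algebra_simps flip: exp_add)
    also have "t * exp (s * t) \<le> exp (s * sqrt x) * z + x powr (- \<beta> / 4) * f z"
    proof -
      have f0: "f z \<ge> 0" by (simp add: f_def)
      consider "z \<le> sqrt x" | "z > sqrt x" "z \<le> \<epsilon> * x" | "z > \<epsilon> * x" by linarith
      then show ?thesis
      proof cases
        case 1
        have "t * exp (s * t) \<le> z * exp (s * sqrt x)"
          using t 1 s by (intro mult_mono) (auto intro: mult_left_mono)
        then show ?thesis using f0 by (simp add: mult.commute add_increasing2)
      next
        case 2
        have "s * z \<le> s * (\<epsilon> * x)" using 2 s by (intro mult_left_mono) auto
        also have "s * (\<epsilon> * x) = \<beta> / 4 * ln x" using that q by (simp add: \<epsilon>_def field_simps)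
        finally have e: "exp (s * z) \<le> x powr (\<beta> / 4)" using that by (simp add: powr_def)
        have "1 < sqrt x" using that by simp
        then have z1: "z > 1" using 2 by linarith
        have "x powr (\<beta> / 2) = sqrt x powr \<beta>" using that by (simp add: powr_half_sqrt[symmetric] powr_powr)
        also have "\<dots> \<le> z powr \<beta>" using 2 \<beta> that by (intro powr_mono2) auto
        finally have "z * x powr (\<beta> / 2) \<le> z * z powr \<beta>" using z1 by (intro mult_left_mono) auto
        also have "\<dots> = f z" using z1 by (simp add: f_def powr_add)
        finally have "z * x powr (\<beta> / 2) * x powr (- \<beta> / 2) \<le> f z * x powr (- \<beta> / 2)"
          by (intro mult_right_mono) auto
        then have zz: "z \<le> f z * x powr (- \<beta> / 2)" using that by (simp add: powr_minus mult.assoc)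
        have "t * exp (s * t) = z * exp (s * z)" using 2 by (simp add: t_def trunc_def)
        also have "\<dots> \<le> (f z * x powr (- \<beta> / 2)) * x powr (\<beta> / 4)"
          using e zz that by (intro mult_mono) auto
        also have "\<dots> = x powr (- \<beta> / 4) * f z" using that by (simp flip: powr_add) 
        finally show ?thesis using that by (simp add: add_increasing)
      next
        case 3
        then show ?thesis using f0 that by (simp add: t_def trunc_def)
      qed
    qed
    finally show ?thesis using s by (simp add: t_def mult_left_mono)
  qed
  have "((\<lambda>x. exp (q * ln x / x * sqrt x) * \<mu> + x powr (- \<beta> / 4) * R) \<longlongrightarrow> 1 * \<mu> + 0 * R) at_top"
  proof (intro tendsto_intros)
    show "((\<lambda>x. exp (q * ln x / x * sqrt x)) \<longlongrightarrow> 1) at_top" by real_asymp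
    show "((\<lambda>x. x powr (- \<beta> / 4)) \<longlongrightarrow> 0) at_top" using \<beta> by real_asymp
  qed
  then have "\<forall>\<^sub>F x in at_top. exp (q * ln x / x * sqrt x) * \<mu> + x powr (- \<beta> / 4) * R < \<mu> + \<delta>"
    using \<delta> by (intro order_tendstoD) auto
  then have "\<forall>\<^sub>F x in at_top. (\<integral>z. exp (q * ln x / x * trunc (\<epsilon> * x) z) \<partial>D) \<le> 1 + q * ln x / x * (\<mu> + \<delta>)"
    using eventually_gt_at_top[of 1]
  proof eventually_elim
    case (elim x)
    define s where "s = q * ln x / x"
    have s: "s \<ge> 0" using elim q by (simp add: s_def)
    let ?g = "\<lambda>z. 1 + s * (exp (s * sqrt x) * z + x powr (- \<beta> / 4) * f z)"
    have g: "integrable D ?g" using int f by (intro Bochner_Integration.integrable_add integrable_mult_right) auto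
    have "AE z in D. exp (s * trunc (\<epsilon> * x) z) \<le> ?g z"
      using nonneg by eventually_elim (rule pointwise[OF s_def elim(2)])
    moreover from this have "integrable D (\<lambda>z. exp (s * trunc (\<epsilon> * x) z))"
      by (intro Bochner_Integration.integrable_bound[OF g]) (auto elim!: eventually_mono)
    ultimately have "(\<integral>z. exp (s * trunc (\<epsilon> * x) z) \<partial>D) \<le> (\<integral>z. ?g z \<partial>D)"
      by (intro integral_mono_AE g)
    also have "\<dots> = 1 + s * (exp (s * sqrt x) * \<mu> + x powr (- \<beta> / 4) * R)"
      using int f prob_space by (simp add: \<mu>_def R_def)
    also have "\<dots> \<le> 1 + s * (\<mu> + \<delta>)"
      using s elim by (intro add_left_mono mult_left_mono) (auto simp: s_def)
    finally show ?case by (simp add: s_def)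
  qed
  with \<epsilon> show thesis unfolding \<mu>_def by (rule that)
qed

end


section \<open>Independent claims\<close>

locale iid_claims = prob_space M for M :: "'a measure" +
  fixes B :: "nat \<Rightarrow> 'a \<Rightarrow> real" and D :: "real measure"
  assumes indep: "indep_vars (\<lambda>_. borel) B {1..}"
    and law: "\<And>i. i \<ge> 1 \<Longrightarrow> distr M borel (B i) = D"
begin

lemma measurable_claim: "i \<ge> 1 \<Longrightarrow> B i \<in> borel_measurable M"
  using indep by (auto simp: indep_vars_def)

lemma real_distribution_law: "real_distribution D"
  using law[of 1] real_distribution_distr[OF measurable_claim[of 1]] by simp

sublocale law: real_distribution D by (rule real_distribution_law)

lemma prob_claim:
  assumes "i \<ge> 1" "A \<in> sets borel"
  shows "prob {\<omega>\<in>space M. B i \<omega> \<in> A} = measure D A"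
proof -
  have "{\<omega>\<in>space M. B i \<omega> \<in> A} = B i -` A \<inter> space M" by auto
  then show ?thesis
    using assms measurable_claim[of i] by (simp flip: law[OF assms(1)] add: measure_distr)
qed

lemma AE_claim:
  assumes "i \<ge> 1" "AE z in D. P z" "Measurable.pred borel P"
  shows "AE \<omega> in M. P (B i \<omega>)"
proof -
  have "AE z in distr M borel (B i). P z" unfolding law[OF assms(1)] by (rule assms(2))
  then show ?thesis using assms(3) measurable_claim[OF assms(1)]
    by (subst (asm) AE_distr_iff) auto
qed

lemma expectation_claim:
  fixes f :: "real \<Rightarrow> real"
  assumes "i \<ge> 1" "f \<in> borel_measurable borel"
  shows "expectation (\<lambda>\<omega>. f (B i \<omega>)) = (\<integral>z. f z \<partial>D)"
  unfolding law[OF assms(1), symmetric]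
  by (rule integral_distr[OF measurable_claim[OF assms(1)] assms(2), symmetric])

lemma integrable_claim:
  assumes "i \<ge> 1" "f \<in> borel_measurable borel" "integrable D f"
  shows "integrable M (\<lambda>\<omega>. f (B i \<omega>) :: real)"
  using integrable_distr_eq[OF measurable_claim[OF assms(1)] assms(2)] assms(3) unfolding law[OF assms(1)] by simp

lemma event_claims:
  assumes "I \<subseteq> {1..}" "X \<in> sets (PiM I (\<lambda>_. borel))"
  shows "{\<omega>\<in>space M. (\<lambda>i\<in>I. B i \<omega>) \<in> X} \<in> events"
proof -
  have "(\<lambda>\<omega>. \<lambda>i\<in>I. B i \<omega>) \<in> measurable M (PiM I (\<lambda>_. borel))"
    using assms(1) by (intro measurable_restrict measurable_claim) auto
  from measurable_sets[OF this assms(2)] show ?thesis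
    by (simp add: vimage_def Int_def conj_commute)
qed

lemma prob_disjoint_claims:
  assumes IJ: "I \<subseteq> {1..}" "J \<subseteq> {1..}" "I \<inter> J = {}"
    and X: "X \<in> sets (PiM I (\<lambda>_. borel))" and Y: "Y \<in> sets (PiM J (\<lambda>_. borel))"
  shows "prob {\<omega>\<in>space M. (\<lambda>i\<in>I. B i \<omega>) \<in> X \<and> (\<lambda>i\<in>J. B i \<omega>) \<in> Y}
       = prob {\<omega>\<in>space M. (\<lambda>i\<in>I. B i \<omega>) \<in> X} * prob {\<omega>\<in>space M. (\<lambda>i\<in>J. B i \<omega>) \<in> Y}"
  using indep_varD[OF indep_var_restrict[OF indep IJ(3,1,2)] X Y]
  by (simp add: vimage_def Int_def conj_commute)

section \<open>Probabilities of configurations of large claims\<close>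

definition jumps :: "real set \<Rightarrow> nat set \<Rightarrow> real \<Rightarrow> 'a set" where
  "jumps A I u = {\<omega>\<in>space M. (\<forall>i\<in>I. B i \<omega> \<in> A) \<and> u < (\<Sum>i\<in>I. B i \<omega>)}"

text \<open>The same event in coordinate space, where independence of disjoint blocks of claims can
  be applied.\<close>

abbreviation jumps_coord :: "real set \<Rightarrow> nat set \<Rightarrow> real \<Rightarrow> (nat \<Rightarrow> real) set" where
  "jumps_coord A I u \<equiv> {f\<in>space (PiM I (\<lambda>_. borel)). (\<forall>i\<in>I. f i \<in> A) \<and> u < (\<Sum>i\<in>I. f i)}"

lemma jumps_coord_sets [measurable]:
  assumes "finite I" and [measurable]: "A \<in> sets borel"
  shows "jumps_coord A I u \<in> sets (PiM I (\<lambda>_. borel))"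
proof -
  have "jumps_coord A I u = (\<Inter>i\<in>I. {f\<in>space (PiM I (\<lambda>_. borel)). f i \<in> A}) \<inter>
      {f\<in>space (PiM I (\<lambda>_. borel)). u < (\<Sum>i\<in>I. f i)}"
    by auto
  moreover have "{f\<in>space (PiM I (\<lambda>_. borel)). u < (\<Sum>i\<in>I. f i)} \<in> sets (PiM I (\<lambda>_. borel :: real measure))"
    by measurable
  moreover have "{f\<in>space (PiM I (\<lambda>_. borel)). f i \<in> A} \<in> sets (PiM I (\<lambda>_. borel))" if "i \<in> I" for i
    using that by measurable
  ultimately show ?thesis
    using assms(1) by (cases "I = {}") (auto intro!: sets.Int sets.finite_INT)
qed

lemma jumps_alt: "jumps A I u = {\<omega>\<in>space M. (\<lambda>i\<in>I. B i \<omega>) \<in> jumps_coord A I u}"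
  by (auto simp: jumps_def space_PiM)

lemma jumps_events:
  assumes "finite I" "I \<subseteq> {1..}" "A \<in> sets borel"
  shows "jumps A I u \<in> events"
  unfolding jumps_alt using assms by (intro event_claims jumps_coord_sets)

lemma antimono_nonneg_indicator: "antimono_nonneg (indicator {..<0})"
  by (auto simp: antimono_nonneg_def antimono_def indicator_def)

text \<open>Induction over \<open>I\<close> by conditioning on one claim, which is independent of
  the others: if it equals \<open>z\<close> in \<open>A\<close>, the others must sum to more than
  \<open>u - z\<close>. Fubini makes this one application of the convolution operator.\<close>

lemma prob_jumps:
  assumes "finite I" "I \<subseteq> {1..}" and A: "A \<in> sets borel" "A \<subseteq> {..b}"
  shows "prob (jumps A I u) = (smear D A ^^ card I) (indicator {..<0}) u"
  using assms(1,2)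
proof (induction I arbitrary: u rule: finite_induct)
  case empty
  show ?case by (auto simp: jumps_def indicator_def prob_space)
next
  case (insert i I)
  define \<phi> where "\<phi> = (smear D A ^^ card I) (indicator {..<0})"
  have \<phi>: "antimono_nonneg \<phi>" unfolding \<phi>_def
    by (rule antimono_nonneg_smear_funpow[OF _ _ A antimono_nonneg_indicator]) (auto intro: law.finite_measure_axioms)
  let ?P = "PiM I (\<lambda>_. borel :: real measure)"
  let ?Y = "\<lambda>\<omega>. \<lambda>i\<in>I. B i \<omega>"
  define N where "N = distr M ?P ?Y"
  have Y: "?Y \<in> measurable M ?P"
    using insert.prems by (intro measurable_restrict measurable_claim) auto
  interpret N: prob_space N unfolding N_def by (rule prob_space_distr[OF Y])
  have i: "i \<ge> 1" using insert.prems by auto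
  let ?P1 = "PiM {i} (\<lambda>_. borel :: real measure)"
  let ?X = "\<lambda>\<omega>. \<lambda>j\<in>{i}. B j \<omega>"
  have X: "?X \<in> measurable M ?P1"
    using i by (intro measurable_restrict measurable_claim) auto
  note [measurable] = A(1) antimono_nonnegD(3)[OF \<phi>]
  have "indep_var ?P1 ?X ?P ?Y"
    using insert by (intro indep_var_restrict[OF indep]) auto
  then have pair: "distr M ?P1 ?X \<Otimes>\<^sub>M N = distr M (?P1 \<Otimes>\<^sub>M ?P) (\<lambda>\<omega>. (?X \<omega>, ?Y \<omega>))"
    unfolding indep_var_distribution_eq N_def by simp
  have XY: "(\<lambda>\<omega>. (?X \<omega>, ?Y \<omega>)) \<in> measurable M (?P1 \<Otimes>\<^sub>M ?P)"
    using X Y by (rule measurable_Pair)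
  define E where "E = {p\<in>space (?P1 \<Otimes>\<^sub>M ?P). fst p i \<in> A \<and> (\<forall>j\<in>I. snd p j \<in> A) \<and> u < fst p i + (\<Sum>j\<in>I. snd p j)}"
  have E: "E \<in> sets (?P1 \<Otimes>\<^sub>M ?P)"
    unfolding E_def using insert.hyps(1)
    by measurable
  have E': "E \<in> sets (distr M ?P1 ?X \<Otimes>\<^sub>M N)"
    using E by (simp add: N_def cong: sets_pair_measure_cong)
  have slice: "emeasure N (Pair f -` E) = ennreal (indicator A (f i) * \<phi> (u - f i))" if "f \<in> space ?P1" for f
  proof -
    have "Pair f -` E = (if f i \<in> A then jumps_coord A I (u - f i) else {})"
      using that by (auto simp: E_def space_pair_measure)
    moreover have "emeasure N (jumps_coord A I (u - f i)) = emeasure M (jumps A I (u - f i))"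
      unfolding N_def jumps_alt using insert.hyps(1) A
      by (subst emeasure_distr[OF Y jumps_coord_sets]) (auto simp: vimage_def Int_def conj_commute)
    moreover have "emeasure M (jumps A I (u - f i)) = ennreal (\<phi> (u - f i))"
      using insert.IH insert.prems by (simp add: emeasure_eq_measure \<phi>_def)
    ultimately show ?thesis by simp
  qed
  have "(\<lambda>\<omega>. (?X \<omega>, ?Y \<omega>)) -` E \<inter> space M = jumps A (insert i I) u"
    using insert.hyps by (auto simp: jumps_def E_def space_pair_measure space_PiM)
  then have "emeasure M (jumps A (insert i I) u) = emeasure (distr M (?P1 \<Otimes>\<^sub>M ?P) (\<lambda>\<omega>. (?X \<omega>, ?Y \<omega>))) E"
    by (subst emeasure_distr[OF XY E]) simp
  also have "\<dots> = (\<integral>\<^sup>+f. emeasure N (Pair f -` E) \<partial>distr M ?P1 ?X)"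
    unfolding pair[symmetric] by (rule N.emeasure_pair_measure_alt[OF E'])
  also have "\<dots> = (\<integral>\<^sup>+\<omega>. emeasure N (Pair (?X \<omega>) -` E) \<partial>M)"
    using N.measurable_emeasure_Pair[OF E'] by (intro nn_integral_distr[OF X]) simp
  also have "\<dots> = (\<integral>\<^sup>+\<omega>. ennreal (indicator A (B i \<omega>) * \<phi> (u - B i \<omega>)) \<partial>M)"
    using slice measurable_space[OF X] by (intro nn_integral_cong) simp
  also have "\<dots> = (\<integral>\<^sup>+z. ennreal (indicator A z * \<phi> (u - z)) \<partial>D)"
    unfolding law[OF i, symmetric]
    by (rule nn_integral_distr[OF measurable_claim[OF i], symmetric]) measurable
  also have "\<dots> = ennreal (smear D A \<phi> u)"
    unfolding smear_def
    by (rule nn_integral_eq_integral[OF integrable_smear[OF law.finite_measure_axioms _ A \<phi>]])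
       (use antimono_nonnegD[OF \<phi>] in auto)
  finally have "ennreal (prob (jumps A (insert i I) u)) = ennreal (smear D A \<phi> u)"
    by (simp add: emeasure_eq_measure)
  moreover have "0 \<le> smear D A \<phi> u"
    using antimono_nonnegD(2)[OF antimono_nonneg_smear[OF law.finite_measure_axioms _ A \<phi>]] by simp
  ultimately show ?case using insert.hyps by (simp add: \<phi>_def)
qed

text \<open>The shift \<open>c * Max I\<close> is moved inside the convolutions and the sum over
  \<open>I\<close> is taken there, where it counts sets. The cut-off \<open>N\<close> loses nothing:
  the counting argument never falls below \<open>u - k * b\<close>, which is at least
  \<open>- c * N\<close>, so every counted set lies in \<open>{1..N}\<close>.\<close>

lemma sum_prob_jumps:
  assumes A: "A \<in> sets borel" "A \<subseteq> {..b}" and "0 \<le> u" "real k * b \<le> c * real N" "k > 0" "c > 0"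
  shows "(\<Sum>I | I \<subseteq> {1..N} \<and> card I = k. prob (jumps A I (u + c * Max I)))
       = (smear D A ^^ k) (subset_count k c) u"
proof -
  let ?S = "{I. I \<subseteq> {1..N} \<and> card I = k}"
  let ?\<phi> = "indicator {..<0} :: real \<Rightarrow> real"
  have fin: "finite ?S" by (rule finite_subset[of _ "Pow {1..N}"]) auto
  have "(\<Sum>I\<in>?S. prob (jumps A I (u + c * Max I))) = (\<Sum>I\<in>?S. (smear D A ^^ k) (\<lambda>v. ?\<phi> (v + c * Max I)) u)"
  proof (rule sum.cong[OF refl])
    fix I assume I: "I \<in> ?S"
    then have "finite I" "I \<subseteq> {1..}" by (auto intro: finite_subset)
    with I show "prob (jumps A I (u + c * Max I)) = (smear D A ^^ k) (\<lambda>v. ?\<phi> (v + c * Max I)) u"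
      using prob_jumps[OF _ _ A, of I] smear_funpow_shift[of k D A ?\<phi> "c * Max I" u] by simp
  qed
  also have "\<dots> = (smear D A ^^ k) (\<lambda>v. \<Sum>I\<in>?S. ?\<phi> (v + c * Max I)) u"
  proof -
    have "antimono_nonneg (\<lambda>v. ?\<phi> (v + c * Max I))" for I :: "nat set"
      by (auto simp: antimono_nonneg_def antimono_def indicator_def)
    then show ?thesis
      by (subst smear_funpow_sum[OF law.finite_measure_axioms _ A]) auto
  qed
  also have "\<dots> = (smear D A ^^ k) (subset_count k c) u"
  proof (rule smear_funpow_cong[OF law.finite_measure_axioms law.events_eq_borel A])
    fix v assume "u - real k * b \<le> v"
    then have v: "- v / c \<le> real N" using assms by (simp add: field_simps)
    \<comment> \<open>The largest \<open>i\<close> with \<open>v + c * i < 0\<close>, or 0 if there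
      is none among the positive integers. Ceiling minus one, rather than floor, because the
      inequality is strict.\<close>
    define r where "r = nat (\<lceil>- v / c\<rceil> - 1)"
    have r: "r \<le> N" using v unfolding r_def by linarith
    have iff: "v + c * real i < 0 \<longleftrightarrow> i \<le> r" if "i \<ge> 1" for i
    proof -
      have "v + c * real i < 0 \<longleftrightarrow> real i < - v / c" using assms(6) by (auto simp: field_simps)
      also have "\<dots> \<longleftrightarrow> i \<le> r" unfolding r_def using that by linarith
      finally show ?thesis .
    qed
    have "(\<Sum>I\<in>?S. ?\<phi> (v + c * Max I)) = real (card {I\<in>?S. v + c * Max I < 0})"
      using fin by (simp add: indicator_def of_bool_def sum.If_cases Int_def)
    also have "{I\<in>?S. v + c * Max I < 0} = {I. I \<subseteq> {1..r} \<and> card I = k}"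
    proof safe
      fix I i assume I: "I \<subseteq> {1..N}" "k = card I" "v + c * Max I < 0" "i \<in> I"
      have "finite I" using I by (auto intro: finite_subset)
      then have "i \<le> Max I" "Max I \<in> I" using I by (auto intro!: Max_ge Max_in)
      with I iff[of "Max I"] show "i \<in> {1..r}" by force
    next
      fix I assume I: "I \<subseteq> {1..r}" "k = card I"
      have "finite I" "I \<noteq> {}" using I assms(5) by (auto intro: finite_subset)
      then have "Max I \<in> I" by (rule Max_in)
      with I iff[of "Max I"] show "v + c * Max I < 0" by force
    qed (use r in force)
    also have "real (card \<dots>) = subset_count k c v"
      by (simp add: n_subsets subset_count_def r_def)
    finally show "(\<Sum>I\<in>?S. ?\<phi> (v + c * Max I)) = subset_count k c v" .
  qed
  finally show ?thesis .
qed

text \<open>A union bound over the sets \<open>J\<close>. The factorial is kept because the number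
  of large claims will later be summed over all sizes.\<close>

lemma prob_many_large:
  assumes S: "S \<in> sets borel"
  shows "prob (\<Union>J\<in>{J. J \<subseteq> {1..n} \<and> card J = k}. {\<omega>\<in>space M. \<forall>j\<in>J. B j \<omega> \<in> S}) \<le> real n ^ k / fact k * measure D S ^ k"
proof -
  let ?S = "{J. J \<subseteq> {1..n} \<and> card J = k}"
  have J: "{\<omega>\<in>space M. \<forall>j\<in>J. B j \<omega> \<in> S} \<in> events \<and> prob {\<omega>\<in>space M. \<forall>j\<in>J. B j \<omega> \<in> S} = measure D S ^ k" if "J \<in> ?S" for J
  proof (cases "J = {}")
    case True
    then show ?thesis using that prob_space by auto
  next
    case False
    have fin: "finite J" using that by (auto intro: finite_subset)
    have eq: "{\<omega>\<in>space M. \<forall>j\<in>J. B j \<omega> \<in> S} = (\<Inter>j\<in>J. B j -` S \<inter> space M)" using False by auto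
    have "prob (\<Inter>j\<in>J. B j -` S \<inter> space M) = (\<Prod>j\<in>J. prob (B j -` S \<inter> space M))"
      using False fin that S by (intro indep_varsD[OF indep]) auto
    also have "\<dots> = (\<Prod>j\<in>J. measure D S)"
    proof (rule prod.cong[OF refl])
      fix j assume "j \<in> J"
      then show "prob (B j -` S \<inter> space M) = measure D S"
        using that prob_claim[of j S] S by (auto simp: vimage_def Int_def conj_commute)
    qed
    finally have "prob {\<omega>\<in>space M. \<forall>j\<in>J. B j \<omega> \<in> S} = measure D S ^ k" using that eq by simp
    moreover
    have "B j -` S \<inter> space M \<in> events" if "j \<in> J" for j
      using that \<open>J \<in> ?S\<close> S by (intro measurable_sets[OF measurable_claim]) auto
    then have "(\<Inter>j\<in>J. B j -` S \<inter> space M) \<in> events"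
      using fin False by (intro sets.finite_INT)
    ultimately show ?thesis by (simp only: eq)
  qed
  have "finite ?S" by (rule finite_subset[of _ "Pow {1..n}"]) auto
  then have "prob (\<Union>J\<in>?S. {\<omega>\<in>space M. \<forall>j\<in>J. B j \<omega> \<in> S}) \<le> (\<Sum>J\<in>?S. prob {\<omega>\<in>space M. \<forall>j\<in>J. B j \<omega> \<in> S})"
    using J by (intro finite_measure_subadditive_finite) auto
  also have "\<dots> = real (n choose k) * measure D S ^ k"
    using J by (simp add: n_subsets)
  also have "\<dots> \<le> real n ^ k / fact k * measure D S ^ k"
  proof -
    have "real ((n choose k) * fact k) \<le> real (n ^ k)" using binomial_fact_pow[of n k] by linarith
    then show ?thesis by (intro mult_right_mono) (auto simp: field_simps)
  qed
  finally show ?thesis .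
qed

end


section \<open>Bounds uniform in time: excess drift, too many large claims, and typical
  behaviour\<close>

lemma power_self_le_exp_fact: "real m ^ m \<le> exp (real m) * fact m"
proof -
  \<comment> \<open>The left-hand side is a single term of the exponential series at
    \<open>m\<close>.\<close>
  have "real m ^ m / fact m = (\<Sum>n\<in>{m}. inverse (fact n) * real m ^ n)"
    by (simp add: field_simps)
  also have "\<dots> \<le> exp (real m)"
    unfolding exp_def real_scaleR_def
    by (rule sum_le_suminf) (use summable_exp[of "real m"] in auto)
  finally show ?thesis by (simp add: field_simps)
qed

context iid_claims
begin

text \<open>Markov's inequality for the exponential at each \<open>n\<close>. The slope
  \<open>v\<close> beats the exponential growth rate by \<open>\<kappa>\<close>, so the bounds form
  a geometric series and the union over all times costs only a constant factor.\<close>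

lemma prob_drift_exceeded:
  fixes f :: "real \<Rightarrow> real"
  assumes f [measurable]: "f \<in> borel_measurable borel" and s: "s > 0" and \<kappa>: "\<kappa> > 0"
    and int: "integrable D (\<lambda>z. exp (s * f z))" and mgf: "(\<integral>z. exp (s * f z) \<partial>D) \<le> exp (s * (v - \<kappa>))"
  shows "prob {\<omega>\<in>space M. \<exists>n. v * real n + w < (\<Sum>i=1..n. f (B i \<omega>))} \<le> exp (- (s * w)) / (1 - exp (- (s * \<kappa>)))"
proof -
  define E where "E n = {\<omega>\<in>space M. v * real n + w < (\<Sum>i=1..n. f (B i \<omega>))}" for n
  have meas: "(\<lambda>\<omega>. \<Sum>i=1..n. f (B i \<omega>)) \<in> borel_measurable M" for n
    by (intro borel_measurable_sum measurable_compose[OF measurable_claim f]) simp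
  have E: "E n \<in> events" for n unfolding E_def using meas[of n] by measurable
  let ?r = "exp (- (s * \<kappa>))"
  have r: "0 \<le> ?r" "?r < 1" using s \<kappa> by auto
  have le: "prob (E n) \<le> exp (- (s * w)) * ?r ^ n" for n
  proof -
    let ?u = "\<lambda>\<omega>. \<Prod>i=1..n. exp (s * f (B i \<omega>))"
    let ?c = "exp (s * (v * n + w))"
    have int_i: "integrable M (\<lambda>\<omega>. exp (s * f (B i \<omega>)))" if "i \<in> {1..n}" for i
      using that by (intro integrable_claim[OF _ _ int]) auto
    have ind: "indep_vars (\<lambda>_. borel) (\<lambda>i \<omega>. exp (s * f (B i \<omega>))) {1..n}"
      by (rule indep_vars_compose2[OF indep_vars_subset[OF indep]]) auto
    have u: "integrable M ?u"
      by (rule indep_vars_integrable[OF _ ind int_i]) auto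
    have "expectation ?u = (\<Prod>i=1..n. expectation (\<lambda>\<omega>. exp (s * f (B i \<omega>))))"
      by (rule indep_vars_lebesgue_integral[OF _ ind int_i]) auto
    also have "\<dots> = (\<Prod>i=1..n. (\<integral>z. exp (s * f z) \<partial>D))"
      by (intro prod.cong refl expectation_claim) auto
    also have "\<dots> = (\<integral>z. exp (s * f z) \<partial>D) ^ n" by simp
    also have "\<dots> \<le> exp (s * (v - \<kappa>)) ^ n"
      using mgf by (intro power_mono) auto
    finally have eu: "expectation ?u \<le> exp (s * (v - \<kappa>)) ^ n" .
    have "prob (E n) \<le> prob {\<omega>\<in>space M. ?u \<omega> \<ge> ?c}"
    proof (rule finite_measure_mono)
      show "E n \<subseteq> {\<omega>\<in>space M. ?u \<omega> \<ge> ?c}"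
        using s by (auto simp: E_def exp_sum[symmetric] sum_distrib_left[symmetric])
      show "{\<omega>\<in>space M. ?u \<omega> \<ge> ?c} \<in> events" using borel_measurable_integrable[OF u] by measurable
    qed
    also have "\<dots> \<le> expectation ?u / ?c"
      by (rule integral_Markov_inequality_measure[OF u, of "{}"]) (auto intro!: AE_I2 prod_nonneg)
    also have "\<dots> \<le> exp (s * (v - \<kappa>)) ^ n / ?c"
      using eu by (intro divide_right_mono) auto
    also have "\<dots> = exp (- (s * w)) * ?r ^ n"
      by (simp add: exp_of_nat_mult[symmetric] exp_diff[symmetric] exp_add[symmetric] algebra_simps)
    finally show ?thesis .
  qed
  have sm: "summable (\<lambda>n. exp (- (s * w)) * ?r ^ n)"
    using r by (intro summable_mult summable_geometric) auto
  have sE: "summable (\<lambda>n. prob (E n))"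
    by (rule summable_comparison_test'[OF sm, of 0]) (use le in auto)
  have "{\<omega>\<in>space M. \<exists>n. v * real n + w < (\<Sum>i=1..n. f (B i \<omega>))} = (\<Union>n. E n)"
    by (auto simp: E_def)
  also have "prob \<dots> \<le> (\<Sum>n. prob (E n))"
    using E sE by (intro finite_measure_subadditive_countably) auto
  also have "\<dots> \<le> (\<Sum>n. exp (- (s * w)) * ?r ^ n)"
    by (intro suminf_le le sE sm)
  also have "\<dots> = exp (- (s * w)) / (1 - ?r)"
    using r by (simp add: suminf_mult suminf_geometric summable_geometric)
  finally show ?thesis .
qed

text \<open>The index range grows with \<open>m\<close> because the ruin time has no fixed bound:
  \<open>m\<close> claims below \<open>a * x\<close> can compensate a drift \<open>c\<close> only up
  to time \<open>m * (a * x / c)\<close>, which suggests \<open>K = a * x / c\<close>.\<close>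

definition many_jumps :: "real set \<Rightarrow> real \<Rightarrow> nat \<Rightarrow> 'a set" where
  "many_jumps S K k = {\<omega>\<in>space M. \<exists>m\<ge>k. \<exists>J\<subseteq>{1..nat \<lfloor>real m * K\<rfloor>}. card J = m \<and> (\<forall>j\<in>J. B j \<omega> \<in> S)}"

text \<open>Sets of size \<open>m\<close> contribute at most \<open>(m * K * p) ^ m / m!\<close>
  with \<open>p = measure D S\<close>. As \<open>m ^ m \<le> exp m * m!\<close>, this is at most
  \<open>r ^ m\<close>, and the geometric series is summed from \<open>k\<close>.\<close>

lemma many_jumps_bound:
  assumes S: "S \<in> sets borel" and K: "K \<ge> 0" and r: "r = exp 1 * K * measure D S" "r < 1"
  shows "many_jumps S K k \<in> events" "prob (many_jumps S K k) \<le> r ^ k / (1 - r)"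
proof -
  define E where "E i = (\<Union>J\<in>{J. J \<subseteq> {1..nat \<lfloor>real (k + i) * K\<rfloor>} \<and> card J = k + i}. {\<omega>\<in>space M. \<forall>j\<in>J. B j \<omega> \<in> S})" for i
  have eq: "many_jumps S K k = (\<Union>i. E i)"
  proof (intro set_eqI iffI)
    fix \<omega> assume "\<omega> \<in> many_jumps S K k"
    then obtain m J where "m \<ge> k" "\<omega> \<in> space M" "J \<subseteq> {1..nat \<lfloor>real m * K\<rfloor>}" "card J = m" "\<forall>j\<in>J. B j \<omega> \<in> S"
      by (auto simp: many_jumps_def)
    moreover from \<open>m \<ge> k\<close> obtain i where "m = k + i" by (auto simp: le_iff_add)
    ultimately have "\<omega> \<in> E i" unfolding E_def by auto
    then show "\<omega> \<in> (\<Union>i. E i)" by auto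
  next
    fix \<omega> assume "\<omega> \<in> (\<Union>i. E i)"
    then obtain i where "\<omega> \<in> E i" by auto
    then show "\<omega> \<in> many_jumps S K k"
      unfolding many_jumps_def E_def by (fastforce intro: exI[of _ "k + i"])
  qed
  have E: "E i \<in> events" for i
  proof -
    have "finite {J. J \<subseteq> {1..nat \<lfloor>real (k + i) * K\<rfloor>} \<and> card J = k + i}"
      by (rule finite_subset[of _ "Pow {1..nat \<lfloor>real (k + i) * K\<rfloor>}"]) auto
    moreover have "{\<omega>\<in>space M. \<forall>j\<in>J. B j \<omega> \<in> S} \<in> events" if J: "J \<subseteq> {1..nat \<lfloor>real (k + i) * K\<rfloor>}" for J
    proof (rule sets.sets_Collect_finite_All)
      show "finite J" using J by (auto intro: finite_subset)
      show "{\<omega>\<in>space M. B j \<omega> \<in> S} \<in> events" if "j \<in> J" for j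
        using measurable_sets[OF measurable_claim[of j] S] that J by (auto simp: vimage_def Int_def conj_commute)
    qed
    ultimately show ?thesis unfolding E_def by (intro sets.finite_UN) auto
  qed
  show "many_jumps S K k \<in> events" unfolding eq using E by auto
  have r0: "r \<ge> 0" using K r by simp
  have le: "prob (E i) \<le> r ^ k * r ^ i" for i
  proof -
    define m where "m = k + i"
    have "prob (E i) \<le> real (nat \<lfloor>real m * K\<rfloor>) ^ m / fact m * measure D S ^ m"
      unfolding E_def m_def by (rule prob_many_large[OF S])
    also have "\<dots> \<le> (real m * K) ^ m / fact m * measure D S ^ m"
      using K by (intro mult_right_mono divide_right_mono power_mono) auto
    also have "\<dots> = real m ^ m * (K * measure D S) ^ m / fact m"
      by (simp add: power_mult_distrib)
    also have "\<dots> \<le> (exp (real m) * fact m) * (K * measure D S) ^ m / fact m"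
      using K power_self_le_exp_fact[of m] by (intro divide_right_mono mult_right_mono) auto
    also have "\<dots> = r ^ m"
      by (simp add: r power_mult_distrib exp_of_nat_mult[symmetric])
    finally show ?thesis by (simp add: m_def power_add)
  qed
  have sm: "summable (\<lambda>i. r ^ k * r ^ i)"
    using r0 r by (intro summable_mult summable_geometric) auto
  have sE: "summable (\<lambda>i. prob (E i))"
    by (rule summable_comparison_test'[OF sm, of 0]) (use le in auto)
  have "prob (many_jumps S K k) \<le> (\<Sum>i. prob (E i))"
    unfolding eq using E sE by (intro finite_measure_subadditive_countably) auto
  also have "\<dots> \<le> (\<Sum>i. r ^ k * r ^ i)"
    by (intro suminf_le le sE sm)
  also have "\<dots> = r ^ k / (1 - r)"
    using r r0 by (simp add: suminf_mult suminf_geometric summable_geometric)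
  finally show "prob (many_jumps S K k) \<le> r ^ k / (1 - r)" .
qed

text \<open>The first condition makes \<open>I\<close> recoverable as the set of large claims, which
  yields disjointness; the second is a law of large numbers for the remaining claims. Truncating
  these at \<open>K\<close> gives the bounded range needed for Hoeffding's inequality.\<close>

definition quiet :: "nat set \<Rightarrow> nat \<Rightarrow> nat \<Rightarrow> real \<Rightarrow> real \<Rightarrow> real \<Rightarrow> 'a set" where
  "quiet I N n t K w = {\<omega>\<in>space M. (\<forall>i\<in>{1..N} - I. B i \<omega> \<le> t) \<and> w < (\<Sum>i\<in>{1..n} - I. trunc K (B i \<omega>))}"

text \<open>Claims inside and outside \<open>I\<close> are independent, so the probability
  factorises. Quietness fails only if another claim exceeds \<open>t\<close>, handled by a union
  bound, or the truncated sum falls \<open>\<epsilon>\<close> below its mean, handled by Hoeffding's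
  inequality.\<close>

lemma quiet_bound:
  assumes nonneg: "AE z in D. 0 \<le> z" and I: "I \<subseteq> {1..N}" "n \<le> N" "N \<ge> 1" and A: "A \<in> sets borel"
    and K: "K > 0" and \<epsilon>: "\<epsilon> > 0"
    and w: "w \<le> real (card ({1..n} - I)) * (\<integral>z. trunc K z \<partial>D) - \<epsilon>"
  shows "quiet I N n t K w \<in> events"
    "prob (jumps A I u \<inter> quiet I N n t K w)
      \<ge> prob (jumps A I u) * (1 - real N * measure D {t<..} - exp (- 2 * \<epsilon>\<^sup>2 / (real N * K\<^sup>2)))"
proof -
  let ?J = "{1..N} - I" and ?S = "{1..n} - I"
  let ?P = "PiM ?J (\<lambda>_. borel :: real measure)"
  have finI: "finite I" using I by (auto intro: finite_subset)
  define Y where "Y = {f\<in>space ?P. (\<forall>i\<in>?J. f i \<le> t) \<and> w < (\<Sum>i\<in>?S. trunc K (f i))}"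
  have Y: "Y \<in> sets ?P"
  proof -
    have [measurable]: "(\<lambda>f. f i) \<in> borel_measurable ?P" if "i \<in> ?J" for i
      using that by (rule measurable_component_singleton)
    have "(\<lambda>f. \<Sum>i\<in>?S. trunc K (f i)) \<in> borel_measurable ?P"
      using I(2) by (intro borel_measurable_sum measurable_compose[OF _ trunc_measurable] measurable_component_singleton) auto
    then have "{f\<in>space ?P. w < (\<Sum>i\<in>?S. trunc K (f i))} \<in> sets ?P" by measurable
    moreover have "{f\<in>space ?P. \<forall>i\<in>?J. f i \<le> t} \<in> sets ?P"
      by (rule sets.sets_Collect_finite_All) (simp_all, measurable)
    ultimately have "{f\<in>space ?P. w < (\<Sum>i\<in>?S. trunc K (f i))} \<inter> {f\<in>space ?P. \<forall>i\<in>?J. f i \<le> t} \<in> sets ?P"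
      by (rule sets.Int)
    also have "{f\<in>space ?P. w < (\<Sum>i\<in>?S. trunc K (f i))} \<inter> {f\<in>space ?P. \<forall>i\<in>?J. f i \<le> t} = Y"
      by (auto simp: Y_def)
    finally show ?thesis .
  qed
  have quiet_alt: "quiet I N n t K w = {\<omega>\<in>space M. (\<lambda>i\<in>?J. B i \<omega>) \<in> Y}"
  proof -
    have "(\<Sum>i\<in>?S. trunc K ((\<lambda>i\<in>?J. B i \<omega>) i)) = (\<Sum>i\<in>?S. trunc K (B i \<omega>))" for \<omega>
      using I(2) by (intro sum.cong) auto
    then show ?thesis by (auto simp: quiet_def Y_def space_PiM)
  qed
  show quiet: "quiet I N n t K w \<in> events"
    unfolding quiet_alt by (rule event_claims[OF _ Y]) auto
  have "jumps A I u \<inter> quiet I N n t K w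
      = {\<omega>\<in>space M. (\<lambda>i\<in>I. B i \<omega>) \<in> jumps_coord A I u \<and> (\<lambda>i\<in>?J. B i \<omega>) \<in> Y}"
    unfolding jumps_alt quiet_alt by auto
  then have indep_eq: "prob (jumps A I u \<inter> quiet I N n t K w) = prob (jumps A I u) * prob (quiet I N n t K w)"
    unfolding jumps_alt quiet_alt
    by (simp only:) (rule prob_disjoint_claims[OF _ _ _ jumps_coord_sets[OF finI A] Y], use I in auto)
  define U where "U = (\<Union>i\<in>?J. {\<omega>\<in>space M. B i \<omega> \<in> {t<..}})"
  define H where "H = {\<omega>\<in>space M. (\<Sum>i\<in>?S. trunc K (B i \<omega>)) \<le> real (card ?S) * (\<integral>z. trunc K z \<partial>D) - \<epsilon>}"
  have large: "{\<omega>\<in>space M. B i \<omega> \<in> {t<..}} \<in> events" if "i \<in> ?J" for i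
    using measurable_sets[OF measurable_claim[of i], of "{t<..}"] that by (auto simp: vimage_def Int_def conj_commute)
  have U: "U \<in> events" unfolding U_def using large by (intro sets.finite_UN) auto
  have "prob U \<le> (\<Sum>i\<in>?J. prob {\<omega>\<in>space M. B i \<omega> \<in> {t<..}})"
    unfolding U_def using large by (intro finite_measure_subadditive_finite) auto
  also have "\<dots> = (\<Sum>i\<in>?J. measure D {t<..})"
    by (intro sum.cong refl prob_claim) auto
  also have "\<dots> = real (card ?J) * measure D {t<..}" by simp
  also have "\<dots> \<le> real N * measure D {t<..}"
    using card_mono[of "{1..N}" ?J] by (intro mult_right_mono) auto
  finally have pU: "prob U \<le> real N * measure D {t<..}" .
  have "(\<lambda>\<omega>. \<Sum>i\<in>?S. trunc K (B i \<omega>)) \<in> borel_measurable M"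
    by (intro borel_measurable_sum measurable_compose[OF measurable_claim trunc_measurable]) auto
  then have H: "H \<in> events" unfolding H_def by measurable
  have pH: "prob H \<le> exp (- 2 * \<epsilon>\<^sup>2 / (real N * K\<^sup>2))"
  proof (cases "?S = {}")
    case True
    \<comment> \<open>With no index left there is no range to apply Hoeffding's inequality to; the
      event reads \<open>0 \<le> - \<epsilon>\<close>.\<close>
    have "H = {}" unfolding H_def True using \<epsilon> by simp
    then show ?thesis by simp
  next
    case False
    then have cS: "card ?S > 0" "card ?S \<le> N" using card_mono[of "{1..n}" ?S] I(2) by (auto simp: card_gt_0_iff)
    interpret Hf: Hoeffding_ineq M ?S "\<lambda>i \<omega>. trunc K (B i \<omega>)" "\<lambda>_. 0" "\<lambda>_. K"
      "\<Sum>i\<in>?S. expectation (\<lambda>\<omega>. trunc K (B i \<omega>))"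
    proof unfold_locales
      show "indep_vars (\<lambda>_. borel) (\<lambda>i \<omega>. trunc K (B i \<omega>)) ?S"
        by (rule indep_vars_compose2[OF indep_vars_subset[OF indep]]) auto
      show "AE \<omega> in M. trunc K (B i \<omega>) \<in> {0..K}" if "i \<in> ?S" for i
      proof -
        have "AE \<omega> in M. 0 \<le> B i \<omega>" using that by (intro AE_claim[OF _ nonneg]) auto
        then show ?thesis by eventually_elim (use K in \<open>auto simp: trunc_def\<close>)
      qed
    qed auto
    have "(\<Sum>i\<in>?S. expectation (\<lambda>\<omega>. trunc K (B i \<omega>))) = real (card ?S) * (\<integral>z. trunc K z \<partial>D)"
      by (simp add: expectation_claim)
    then have "prob H \<le> exp (- 2 * \<epsilon>\<^sup>2 / (\<Sum>i\<in>?S. (K - 0)\<^sup>2))"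
      unfolding H_def using Hf.Hoeffding_ineq_le[of \<epsilon>] \<epsilon> K cS by simp
    also have "\<dots> \<le> exp (- 2 * \<epsilon>\<^sup>2 / (real N * K\<^sup>2))"
      using cS K \<epsilon> by (auto intro!: divide_left_mono mult_right_mono mult_pos_pos)
    finally show ?thesis .
  qed
  have "space M \<subseteq> quiet I N n t K w \<union> (U \<union> H)"
    using w by (auto simp: quiet_def U_def H_def not_le)
  then have "prob (space M) \<le> prob (quiet I N n t K w \<union> (U \<union> H))"
    using quiet U H by (intro finite_measure_mono) auto
  also have "\<dots> \<le> prob (quiet I N n t K w) + (prob U + prob H)"
    using measure_Un_le[OF quiet, of "U \<union> H"] measure_Un_le[OF U H] U H by auto
  finally have "1 - real N * measure D {t<..} - exp (- 2 * \<epsilon>\<^sup>2 / (real N * K\<^sup>2)) \<le> prob (quiet I N n t K w)"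
    using pU pH by (simp add: prob_space)
  then show "prob (jumps A I u \<inter> quiet I N n t K w)
      \<ge> prob (jumps A I u) * (1 - real N * measure D {t<..} - exp (- 2 * \<epsilon>\<^sup>2 / (real N * K\<^sup>2)))"
    unfolding indep_eq by (intro mult_left_mono) auto
qed

end


section \<open>Ruin probabilities\<close>

lemma tendsto_0_sandwich:
  fixes f g :: "'a \<Rightarrow> real"
  assumes "\<forall>\<^sub>F x in F. f x \<le> g x" "(g \<longlongrightarrow> 0) F" "\<forall>\<^sub>F x in F. 0 \<le> f x"
  shows "(f \<longlongrightarrow> 0) F"
  by (rule tendsto_sandwich[OF assms(3,1) tendsto_const assms(2)])

text \<open>The last two assumptions say that \<open>k - 1\<close> retained claims stay below the
  level \<open>x\<close> by a fixed proportion, while \<open>k\<close> of them can exceed it by a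
  fixed proportion.\<close>

locale reinsured_claims = iid_claims M B D + heavy_tail D \<alpha>
  for M :: "'a measure" and B :: "nat \<Rightarrow> 'a \<Rightarrow> real" and D :: "real measure" and \<alpha> :: real +
  fixes a :: real and k :: nat
  assumes alpha_gt: "\<alpha> > 1"
    and law_nonneg: "AE z in D. 0 \<le> z"
    and law_integrable: "integrable D (\<lambda>z. z)"
    and net_profit: "(\<integral>z. z \<partial>D) < 1"
    and a_pos: "a > 0"
    and k_low: "(real k - 1) * a < 1" and k_high: "1 < real k * a"
begin

definition \<mu> :: real where "\<mu> = (\<integral>z. z \<partial>D)"

text \<open>If \<open>k\<close> claims below \<open>a x\<close> sum to more than \<open>(1 - \<eta>) x\<close> with \<open>\<eta> \<le> e\<close>, then each of them exceeds \<open>e x\<close>.  Hence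
  the window \<open>(e x, a x)\<close> need not depend on the truncation level of the small claims.\<close>
definition e :: real where "e = (1 - (real k - 1) * a) / 2"

lemma e_bounds: "0 < e" "e < a"
  using k_low k_high by (auto simp: e_def field_simps)

lemma k_pos: "k > 0"
  using k_high by (cases k) auto

lemma e_le_half: "e \<le> 1 / 2"
proof -
  have "0 \<le> (real k - 1) * a" using k_pos a_pos by (intro mult_nonneg_nonneg) auto
  then show ?thesis by (simp add: e_def)
qed

sublocale heavy_tail_window D \<alpha> e a
  by unfold_locales (rule e_bounds)+

definition ruin :: "real \<Rightarrow> 'a set" where
  "ruin x = {\<omega>\<in>space M. \<exists>n. x < reinsured_walk B a x n \<omega>}"

lemma ruin_prob_eq: "ruin_prob M B a x = prob (ruin x)"
  by (simp add: ruin_prob_def ruin_def less_SUP_iff)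

abbreviation capped :: "real \<Rightarrow> real \<Rightarrow> real" where
  "capped x z \<equiv> z * indicator {..<a * x} z"

lemma reinsured_walk_eq: "reinsured_walk B a x n \<omega> = (\<Sum>i=1..n. capped x (B i \<omega>)) - real n"
  by (simp add: reinsured_walk_def sum_subtractf)

lemma ruin_events: "ruin x \<in> events"
proof -
  have "(\<lambda>\<omega>. reinsured_walk B a x n \<omega>) \<in> borel_measurable M" for n
    unfolding reinsured_walk_eq
    by (intro borel_measurable_diff borel_measurable_const borel_measurable_sum
        measurable_compose[OF measurable_claim, where g = "capped x"]) auto
  then show ?thesis unfolding ruin_def by measurable
qed

definition drift :: "real \<Rightarrow> real \<Rightarrow> real \<Rightarrow> 'a set" where
  "drift \<epsilon> \<eta> x = {\<omega>\<in>space M. \<exists>n. (\<mu> + \<eta>) * real n + \<eta> * x < (\<Sum>i=1..n. trunc (\<epsilon> * x) (B i \<omega>))}"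

text \<open>Off the drift event, the claims of order \<open>x\<close> must outweigh
  \<open>(1 - \<eta>) * x + c * n\<close> at a ruin time \<open>n\<close>. Each is below
  \<open>a * x\<close>, so at least \<open>k\<close> are needed and \<open>n\<close> is bounded in
  terms of their number. More than \<open>k\<close> is the second event; exactly \<open>k\<close>
  gives the third, because \<open>n \<ge> Max J\<close>.\<close>

lemma ruin_subset:
  assumes \<eta>: "0 < \<eta>" "\<eta> \<le> e" "\<eta> < 1 - \<mu>" and c: "c = 1 - \<mu> - \<eta>" and x: "x > 0"
    and N: "real k * (a * x) \<le> c * real N"
  shows "ruin x \<subseteq> drift \<epsilon> \<eta> x \<union> many_jumps {\<epsilon> * x<..} (a * x / c) (Suc k)
    \<union> (\<Union>I\<in>{I. I \<subseteq> {1..N} \<and> card I = k}. jumps (W x) I ((1 - \<eta>) * x + c * Max I))"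
proof
  fix \<omega> assume \<omega>: "\<omega> \<in> ruin x"
  then have sp: "\<omega> \<in> space M" by (simp add: ruin_def)
  from \<omega> obtain n where n: "x + real n < (\<Sum>i=1..n. capped x (B i \<omega>))"
    by (auto simp: ruin_def reinsured_walk_eq algebra_simps)
  have c0: "c > 0" using c \<eta> by simp
  show "\<omega> \<in> drift \<epsilon> \<eta> x \<union> many_jumps {\<epsilon> * x<..} (a * x / c) (Suc k)
    \<union> (\<Union>I\<in>{I. I \<subseteq> {1..N} \<and> card I = k}. jumps (W x) I ((1 - \<eta>) * x + c * Max I))"
  proof (cases "\<omega> \<in> drift \<epsilon> \<eta> x")
    case False
    then have dr: "(\<Sum>i=1..n. trunc (\<epsilon> * x) (B i \<omega>)) \<le> (\<mu> + \<eta>) * real n + \<eta> * x"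
      using sp by (auto simp: drift_def not_less)
    define J where "J = {i\<in>{1..n}. \<epsilon> * x < B i \<omega> \<and> B i \<omega> < a * x}"
    have J: "finite J" "J \<subseteq> {1..n}" by (auto simp: J_def)
    have "capped x (B i \<omega>) \<le> trunc (\<epsilon> * x) (B i \<omega>) + (if i \<in> J then B i \<omega> else 0)" if "i \<in> {1..n}" for i
    proof -
      \<comment> \<open>A claim of at least \<open>a * x\<close> contributes 0 on the left and is
        positive anyway, so the inclusion holds for every \<open>\<omega>\<close> and not merely
        almost surely.\<close>
      have "0 < a * x" using a_pos x by simp
      then have "0 \<le> B i \<omega>" if "\<not> B i \<omega> < a * x" using that by linarith
      then show ?thesis using that by (auto simp: J_def trunc_def indicator_def)
    qed
    then have "(\<Sum>i=1..n. capped x (B i \<omega>)) \<le> (\<Sum>i=1..n. trunc (\<epsilon> * x) (B i \<omega>) + (if i \<in> J then B i \<omega> else 0))"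
      by (intro sum_mono) auto
    also have "\<dots> = (\<Sum>i=1..n. trunc (\<epsilon> * x) (B i \<omega>)) + (\<Sum>i\<in>J. B i \<omega>)"
      using J by (simp add: sum.distrib sum.If_cases Int_absorb1)
    finally have sumJ: "(1 - \<eta>) * x + c * real n < (\<Sum>i\<in>J. B i \<omega>)"
      using n dr by (simp add: c algebra_simps)
    define m where "m = card J"
    have part: "(\<Sum>i\<in>J'. B i \<omega>) \<le> real (card J') * (a * x)" if "J' \<subseteq> J" for J'
    proof -
      have "(\<Sum>i\<in>J'. B i \<omega>) \<le> (\<Sum>i\<in>J'. a * x)" using that by (intro sum_mono) (auto simp: J_def)
      then show ?thesis by simp
    qed
    have mx: "(1 - \<eta>) * x + c * real n < real m * (a * x)"
      using sumJ part[of J] by (simp add: m_def)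
    have "(real k - 1) * a < 1 - \<eta>" using \<eta> e_bounds by (simp add: e_def field_simps)
    then have "(real k - 1) * a * x < (1 - \<eta>) * x" using x by (rule mult_strict_right_mono)
    also have "\<dots> \<le> (1 - \<eta>) * x + c * real n" using c0 by simp
    also note mx
    finally have "(real k - 1) * (a * x) < real m * (a * x)" by simp
    moreover have "a * x > 0" using a_pos x by simp
    ultimately have "real k - 1 < real m" by (simp only: mult_less_cancel_right_pos)
    then have mk: "m \<ge> k" by linarith
    have "0 \<le> (1 - \<eta>) * x" using x \<eta> e_le_half by (intro mult_nonneg_nonneg) auto
    with mx have "c * real n \<le> real m * (a * x)" by linarith
    then have nm: "real n \<le> real m * (a * x / c)" using c0 by (simp add: field_simps)
    show ?thesis
    proof (cases "m = k")
      case False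
      then have "Suc k \<le> m" using mk by simp
      moreover have "n \<le> nat \<lfloor>real m * (a * x / c)\<rfloor>" using nm by linarith
      then have "J \<subseteq> {1..nat \<lfloor>real m * (a * x / c)\<rfloor>}" using J(2) by auto
      moreover have "\<forall>j\<in>J. B j \<omega> \<in> {\<epsilon> * x<..}" by (auto simp: J_def)
      ultimately have "\<omega> \<in> many_jumps {\<epsilon> * x<..} (a * x / c) (Suc k)"
        unfolding many_jumps_def using sp by (auto simp: m_def)
      then show ?thesis by simp
    next
      case True
      have "c * real n \<le> c * real N" using \<open>c * real n \<le> real m * (a * x)\<close> N True by simp
      then have "n \<le> N" using c0 by simp
      then have JN: "J \<subseteq> {1..N}" using J by auto
      have "J \<noteq> {}" using True k_pos by (auto simp: m_def)
      then have "Max J \<in> J" using J by (intro Max_in)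
      then have "Max J \<le> n" using J by auto
      then have "c * real (Max J) \<le> c * real n" using c0 by simp
      then have s: "(1 - \<eta>) * x + c * real (Max J) < (\<Sum>i\<in>J. B i \<omega>)" using sumJ by linarith
      have "B j \<omega> \<in> W x" if j: "j \<in> J" for j
      proof -
        \<comment> \<open>The other \<open>k - 1\<close> claims supply at most
          \<open>(k - 1) * a * x\<close>, leaving at least
          \<open>(2 * e - \<eta>) * x \<ge> e * x\<close> for claim \<open>j\<close>.\<close>
        have "(\<Sum>i\<in>J. B i \<omega>) = B j \<omega> + (\<Sum>i\<in>J - {j}. B i \<omega>)" using j J by (simp add: sum.remove)
        also have "(\<Sum>i\<in>J - {j}. B i \<omega>) \<le> real (card (J - {j})) * (a * x)" by (rule part) auto
        also have "real (card (J - {j})) = real k - 1" using j J True k_pos by (simp add: m_def)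
        finally have "(1 - \<eta>) * x - (real k - 1) * (a * x) < B j \<omega>"
          using sumJ mult_nonneg_nonneg[of c "real n"] c0 by linarith
        moreover have "e * x \<le> (1 - \<eta> - (real k - 1) * a) * x"
          using \<eta> x by (intro mult_right_mono) (auto simp: e_def field_simps)
        ultimately have "e * x < B j \<omega>" by (simp add: algebra_simps)
        then show ?thesis using j by (simp add: J_def)
      qed
      then have "\<omega> \<in> jumps (W x) J ((1 - \<eta>) * x + c * Max J)"
        using s sp by (simp add: jumps_def)
      then show ?thesis using JN True by (auto simp: m_def)
    qed
  qed simp
qed

section \<open>Events that are negligible against \<open>(x * V x) ^ k\<close>\<close>

lemma x_tail_null: "((\<lambda>x. x * V x) \<longlongrightarrow> 0) at_top"
proof -
  define p where "p = (1 + \<alpha>) / 2"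
  have p: "1 < p" "p < \<alpha>" using alpha_gt by (auto simp: p_def)
  let ?f = "\<lambda>z :: real. indicator {1<..} z * z powr p"
  have f: "integrable D ?f" by (rule integrable_power_moment) (use p in auto)
  define R where "R = (\<integral>z. ?f z \<partial>D)"
  have "\<forall>\<^sub>F x in at_top. x * V x \<le> x powr (1 - p) * R"
    using eventually_ge_at_top[of 1]
  proof eventually_elim
    case (elim x)
    have "V x \<le> measure D {z\<in>space D. ?f z \<ge> x powr p}"
      using elim p by (intro law.finite_measure_mono) (auto intro!: powr_mono2)
    also have "\<dots> \<le> R / x powr p"
      unfolding R_def by (rule integral_Markov_inequality_measure[OF f, of "{}"]) (use elim in auto)
    finally have "x * V x \<le> x * (R / x powr p)" using elim by (intro mult_left_mono) auto
    also have "\<dots> = x powr (1 - p) * R" using elim by (simp add: powr_diff)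
    finally show ?case .
  qed
  moreover have "((\<lambda>x. x powr (1 - p) * R) \<longlongrightarrow> 0) at_top"
    using p by (intro tendsto_mult_left_zero tendsto_neg_powr filterlim_ident) auto
  moreover have "\<forall>\<^sub>F x in at_top. 0 \<le> x * V x"
    using eventually_ge_at_top[of 0] by eventually_elim simp
  ultimately show ?thesis by (rule tendsto_0_sandwich)
qed

lemma drift_events: "drift \<epsilon> \<eta> x \<in> events"
proof -
  have "(\<lambda>\<omega>. \<Sum>i=1..n. trunc (\<epsilon> * x) (B i \<omega>)) \<in> borel_measurable M" for n
    by (intro borel_measurable_sum measurable_compose[OF measurable_claim trunc_measurable]) auto
  then show ?thesis unfolding drift_def by measurable
qed

text \<open>The geometric series costs a factor of order \<open>x / ln x\<close>, since its ratio
  tends to 1. Hence the rate is chosen to gain \<open>x powr - 2\<close> beyond the power lower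
  bound for \<open>(x * V x) ^ k\<close>.\<close>

lemma drift_negligible:
  assumes \<eta>: "\<eta> > 0"
  obtains \<epsilon> where "\<epsilon> > 0" "((\<lambda>x. prob (drift \<epsilon> \<eta> x) / (x * V x) ^ k) \<longlongrightarrow> 0) at_top"
proof -
  \<comment> \<open>Then the offset \<open>\<eta> * x\<close> of the drift line contributes exactly
    \<open>x powr - (\<alpha> * k + 2)\<close>.\<close>
  define q where "q = (\<alpha> * k + 2) / \<eta>"
  have q: "q > 0" using \<eta> alpha_pos by (auto simp: q_def intro!: divide_pos_pos add_nonneg_pos)
  obtain \<epsilon> where \<epsilon>: "\<epsilon> > 0"
    and mgf: "\<forall>\<^sub>F x in at_top. (\<integral>z. exp (q * ln x / x * trunc (\<epsilon> * x) z) \<partial>D) \<le> 1 + q * ln x / x * (\<mu> + \<eta> / 2)"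
    using truncated_exp_moment[OF alpha_gt law_nonneg law_integrable q, of "\<eta> / 2"] \<eta>
    unfolding \<mu>_def by auto
  \<comment> \<open>With exponent \<open>\<alpha> + 1\<close> the extra factor \<open>x\<close>
    gives \<open>x * V x \<ge> c0 * x powr - \<alpha>\<close>, matching the term
    \<open>\<alpha> * k\<close> in \<open>q\<close>.\<close>
  obtain c0 where c0: "c0 > 0" "\<forall>\<^sub>F x in at_top. V x \<ge> c0 * x powr - (\<alpha> + 1)"
    using tail_power_lower_bound[of "\<alpha> + 1"] by auto
  define \<kappa> where "\<kappa> = q * \<eta> / 2"
  have \<kappa>: "\<kappa> > 0" using q \<eta> by (simp add: \<kappa>_def)
  have "\<forall>\<^sub>F x in at_top. prob (drift \<epsilon> \<eta> x) / (x * V x) ^ k \<le> x powr - 2 / (1 - exp (- (\<kappa> * ln x / x))) / c0 ^ k"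
    using mgf c0(2) eventually_gt_at_top[of 1]
  proof eventually_elim
    case (elim x)
    define s where "s = q * ln x / x"
    have s: "s > 0" using q elim by (simp add: s_def)
    have "prob (drift \<epsilon> \<eta> x) \<le> exp (- (s * (\<eta> * x))) / (1 - exp (- (s * (\<eta> / 2))))"
      unfolding drift_def
    proof (rule prob_drift_exceeded[OF trunc_measurable s])
      have "s * trunc (\<epsilon> * x) z \<le> s * (\<epsilon> * x)" for z
        using s \<epsilon> elim by (intro mult_left_mono) (auto simp: trunc_def)
      then show "integrable D (\<lambda>z. exp (s * trunc (\<epsilon> * x) z))"
        by (intro law.integrable_const_bound[where B = "exp (s * (\<epsilon> * x))"]) auto
      have "(\<integral>z. exp (s * trunc (\<epsilon> * x) z) \<partial>D) \<le> 1 + s * (\<mu> + \<eta> / 2)"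
        using elim by (simp add: s_def)
      also have "\<dots> \<le> exp (s * (\<mu> + \<eta> / 2))" by (rule exp_ge_add_one_self)
      finally show "(\<integral>z. exp (s * trunc (\<epsilon> * x) z) \<partial>D) \<le> exp (s * (\<mu> + \<eta> - \<eta> / 2))" by (simp add: add.commute)
    qed (use \<eta> in simp)
    also have "s * (\<eta> * x) = (\<alpha> * k + 2) * ln x" using elim \<eta> by (simp add: s_def q_def)
    also have "exp (- ((\<alpha> * k + 2) * ln x)) = x powr - 2 * x powr - (\<alpha> * k)"
    proof -
      have "exp (- ((\<alpha> * k + 2) * ln x)) = x powr (- 2 + - (\<alpha> * k))"
        using elim by (simp add: powr_def algebra_simps)
      then show ?thesis by (simp only: powr_add)
    qed
    also have "s * (\<eta> / 2) = \<kappa> * ln x / x" by (simp add: s_def \<kappa>_def mult_ac)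
    finally have P: "prob (drift \<epsilon> \<eta> x) \<le> x powr - 2 / (1 - exp (- (\<kappa> * ln x / x))) * x powr - (\<alpha> * k)"
      by simp
    have "(c0 * x powr - \<alpha>) ^ k \<le> (x * V x) ^ k"
    proof (rule power_mono)
      have "c0 * x powr - \<alpha> = x * (c0 * x powr - (\<alpha> + 1))"
        using elim powr_add[of x 1 "- (\<alpha> + 1)"] by simp
      also have "\<dots> \<le> x * V x" using elim by (intro mult_left_mono) auto
      finally show "c0 * x powr - \<alpha> \<le> x * V x" .
    qed (use c0 in simp)
    moreover have "(c0 * x powr - \<alpha>) ^ k = c0 ^ k * x powr - (\<alpha> * k)"
      using elim by (simp add: power_mult_distrib powr_power mult.commute)
    ultimately have "x powr - (\<alpha> * k) \<le> (x * V x) ^ k / c0 ^ k"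
      using c0 by (simp add: field_simps)
    moreover have "exp (- (\<kappa> * ln x / x)) \<le> 1" using \<kappa> elim by simp
    ultimately have "prob (drift \<epsilon> \<eta> x) \<le> x powr - 2 / (1 - exp (- (\<kappa> * ln x / x))) * ((x * V x) ^ k / c0 ^ k)"
      by (intro order_trans[OF P] mult_left_mono) auto
    moreover have "(x * V x) ^ k > 0" using elim tail_pos[of x] by simp
    ultimately show ?case by (simp add: pos_divide_le_eq)
  qed
  moreover have "((\<lambda>x. x powr - 2 / (1 - exp (- (\<kappa> * ln x / x))) / c0 ^ k) \<longlongrightarrow> 0) at_top"
  proof (rule tendsto_divide_zero)
    show "((\<lambda>x. x powr - 2 / (1 - exp (- (\<kappa> * ln x / x)))) \<longlongrightarrow> 0) at_top"
      using \<kappa> by real_asymp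
  qed
  moreover have "\<forall>\<^sub>F x in at_top. 0 \<le> prob (drift \<epsilon> \<eta> x) / (x * V x) ^ k"
    using eventually_ge_at_top[of 0] by eventually_elim auto
  ultimately have "((\<lambda>x. prob (drift \<epsilon> \<eta> x) / (x * V x) ^ k) \<longlongrightarrow> 0) at_top"
    by (rule tendsto_0_sandwich)
  with \<epsilon> show thesis by (rule that)
qed

text \<open>The ratio \<open>r x\<close> of the geometric bound is asymptotic to a constant times
  \<open>x * V x\<close>, so \<open>r x ^ Suc k\<close> has one vanishing factor to spare.\<close>

lemma many_jumps_negligible:
  assumes c: "c > 0" and \<epsilon>: "\<epsilon> > 0"
  defines "E \<equiv> \<lambda>x. many_jumps {\<epsilon> * x<..} (a * x / c) (Suc k)"
  shows "\<forall>\<^sub>F x in at_top. E x \<in> events" "((\<lambda>x. prob (E x) / (x * V x) ^ k) \<longlongrightarrow> 0) at_top"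
proof -
  define r where "r x = exp 1 * (a * x / c) * V (\<epsilon> * x)" for x
  define C where "C = exp 1 * a / c"
  have "((\<lambda>x. C * (V (\<epsilon> * x) / V x)) \<longlongrightarrow> C * \<epsilon> powr - \<alpha>) at_top"
    by (intro tendsto_intros tail_regular \<epsilon>)
  moreover have "\<forall>\<^sub>F x in at_top. C * (V (\<epsilon> * x) / V x) = r x / (x * V x)"
    using eventually_gt_at_top[of 0] by eventually_elim (simp add: r_def C_def)
  ultimately have r1: "((\<lambda>x. r x / (x * V x)) \<longlongrightarrow> C * \<epsilon> powr - \<alpha>) at_top"
    by (rule Lim_transform_eventually)
  have "((\<lambda>x. r x / (x * V x) * (x * V x)) \<longlongrightarrow> C * \<epsilon> powr - \<alpha> * 0) at_top"
    by (intro tendsto_mult r1 x_tail_null)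
  moreover have "\<forall>\<^sub>F x in at_top. r x / (x * V x) * (x * V x) = r x"
    using eventually_gt_at_top[of 0] by eventually_elim (use tail_pos in \<open>simp add: less_imp_neq[symmetric]\<close>)
  ultimately have r0: "(r \<longlongrightarrow> 0) at_top"
    by (simp add: tendsto_cong)
  have r_lt: "\<forall>\<^sub>F x in at_top. r x < 1" by (rule order_tendstoD(2)[OF r0]) simp
  show "\<forall>\<^sub>F x in at_top. E x \<in> events"
    using r_lt eventually_gt_at_top[of 0]
    by eventually_elim (auto simp: E_def r_def intro!: many_jumps_bound(1)[OF _ _ refl] divide_nonneg_pos c
        mult_nonneg_nonneg less_imp_le[OF a_pos])
  have "\<forall>\<^sub>F x in at_top. prob (E x) / (x * V x) ^ k \<le> (r x / (x * V x)) ^ k * (r x / (1 - r x))"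
    using r_lt eventually_gt_at_top[of 0]
  proof eventually_elim
    case (elim x)
    have "prob (E x) \<le> r x ^ Suc k / (1 - r x)"
      unfolding E_def r_def using elim a_pos c
      by (intro many_jumps_bound(2)[OF _ _ refl]) (auto simp: r_def)
    then have "prob (E x) / (x * V x) ^ k \<le> r x ^ Suc k / (1 - r x) / (x * V x) ^ k"
      using elim by (intro divide_right_mono) auto
    then show ?case by (simp add: power_divide mult.commute)
  qed
  moreover have "((\<lambda>x. (r x / (x * V x)) ^ k * (r x / (1 - r x))) \<longlongrightarrow> 0) at_top"
  proof -
    have "((\<lambda>x. (r x / (x * V x)) ^ k * (r x / (1 - r x))) \<longlongrightarrow> (C * \<epsilon> powr - \<alpha>) ^ k * (0 / (1 - 0))) at_top"
      by (intro tendsto_mult tendsto_divide tendsto_power tendsto_diff tendsto_const r1 r0) auto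
    then show ?thesis by simp
  qed
  moreover have "\<forall>\<^sub>F x in at_top. 0 \<le> prob (E x) / (x * V x) ^ k"
    using eventually_ge_at_top[of 0] by eventually_elim auto
  ultimately show "((\<lambda>x. prob (E x) / (x * V x) ^ k) \<longlongrightarrow> 0) at_top"
    by (rule tendsto_0_sandwich)
qed

section \<open>The asymptotic upper bound\<close>

lemma ruin_upper:
  assumes \<eta>: "0 < \<eta>" "\<eta> \<le> e" "\<eta> < 1 - \<mu>" and y: "\<Gamma> k (1 - \<eta>) / (1 - \<mu> - \<eta>) ^ k < y"
  shows "\<forall>\<^sub>F x in at_top. prob (ruin x) / (x * V x) ^ k < y"
proof -
  define c where "c = 1 - \<mu> - \<eta>"
  have c: "c > 0" using \<eta> by (simp add: c_def)
  obtain \<epsilon> where \<epsilon>: "\<epsilon> > 0" and dr: "((\<lambda>x. prob (drift \<epsilon> \<eta> x) / (x * V x) ^ k) \<longlongrightarrow> 0) at_top"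
    using drift_negligible[OF \<eta>(1)] by auto
  let ?E = "\<lambda>x. many_jumps {\<epsilon> * x<..} (a * x / c) (Suc k)"
  let ?T = "\<lambda>x. (smear D (W x) ^^ k) (subset_count k c) ((1 - \<eta>) * x)"
  have "((\<lambda>x. prob (drift \<epsilon> \<eta> x) / (x * V x) ^ k + prob (?E x) / (x * V x) ^ k + ?T x / (x * V x) ^ k)
      \<longlongrightarrow> 0 + 0 + \<Gamma> k (1 - \<eta>) / c ^ k) at_top"
    by (intro tendsto_add dr many_jumps_negligible(2) c \<epsilon> subset_count_smear_limit k_pos)
  then have "\<forall>\<^sub>F x in at_top. prob (drift \<epsilon> \<eta> x) / (x * V x) ^ k + prob (?E x) / (x * V x) ^ k + ?T x / (x * V x) ^ k < y"
    using y by (intro order_tendstoD) (auto simp: c_def)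
  then show ?thesis
    using many_jumps_negligible(1)[OF c \<epsilon>] eventually_gt_at_top[of 0]
  proof eventually_elim
    case (elim x)
    \<comment> \<open>Beyond this time even \<open>k\<close> claims of the maximal retained size
      cannot compensate a drift \<open>c\<close>.\<close>
    define N where "N = nat \<lceil>real k * (a * x) / c\<rceil>"
    have "real k * (a * x) / c \<le> real N" unfolding N_def by linarith
    then have N: "real k * (a * x) \<le> c * real N" using c by (simp add: field_simps)
    let ?S = "{I. I \<subseteq> {1..N} \<and> card I = k}"
    let ?j = "\<lambda>I. jumps (W x) I ((1 - \<eta>) * x + c * Max I)"
    have fin: "finite ?S" by (rule finite_subset[of _ "Pow {1..N}"]) auto
    have j: "?j I \<in> events" if "I \<in> ?S" for I
      using that by (intro jumps_events) (auto intro: finite_subset)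
    then have U: "(\<Union>I\<in>?S. ?j I) \<in> events" using fin by (intro sets.finite_UN)
    have "prob (ruin x) \<le> prob (drift \<epsilon> \<eta> x \<union> ?E x \<union> (\<Union>I\<in>?S. ?j I))"
      using ruin_subset[OF \<eta> c_def elim(3) N] drift_events elim U by (intro finite_measure_mono sets.Un)
    also have "\<dots> \<le> prob (drift \<epsilon> \<eta> x) + prob (?E x) + prob (\<Union>I\<in>?S. ?j I)"
      using measure_Un_le[of "drift \<epsilon> \<eta> x \<union> ?E x" M "\<Union>I\<in>?S. ?j I"] measure_Un_le[of "drift \<epsilon> \<eta> x" M "?E x"]
        drift_events[of \<epsilon> \<eta> x] elim U by auto
    also have "prob (\<Union>I\<in>?S. ?j I) \<le> (\<Sum>I\<in>?S. prob (?j I))"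
      using fin j by (intro finite_measure_subadditive_finite) auto
    also have "\<dots> = ?T x"
    proof (rule sum_prob_jumps[OF _ _ _ N k_pos c])
      have "\<eta> < 1" using \<eta> e_le_half by simp
      then show "0 \<le> (1 - \<eta>) * x" using elim by simp
    qed auto
    finally have "prob (ruin x) \<le> prob (drift \<epsilon> \<eta> x) + prob (?E x) + ?T x" by simp
    then have "prob (ruin x) / (x * V x) ^ k \<le> (prob (drift \<epsilon> \<eta> x) + prob (?E x) + ?T x) / (x * V x) ^ k"
      using elim by (intro divide_right_mono) auto
    with elim show ?case by (simp add: add_divide_distrib)
  qed
qed


section \<open>The asymptotic lower bound\<close>

lemma mu_less_1: "\<mu> < 1"
  using net_profit by (simp add: \<mu>_def)

text \<open>The level \<open>K\<close> does not depend on \<open>x\<close>, so the Hoeffding error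
  at times of order \<open>x\<close> is exponentially small in \<open>x\<close>.\<close>

lemma trunc_mean_close:
  assumes "\<eta> > 0"
  obtains K where "K > 0" "(\<integral>z. trunc K z \<partial>D) \<ge> \<mu> - \<eta>"
proof -
  have "(\<lambda>n. \<integral>z. trunc (real (Suc n)) z \<partial>D) \<longlonglongrightarrow> \<mu>"
    unfolding \<mu>_def
  proof (rule integral_dominated_convergence[where w = "\<lambda>z. \<bar>z\<bar>"])
    show "AE z in D. (\<lambda>n. trunc (real (Suc n)) z) \<longlonglongrightarrow> z"
    proof (rule AE_I2)
      fix z :: real
      obtain n0 :: nat where "z \<le> real n0" using real_arch_simple by auto
      then have "\<forall>\<^sub>F n in sequentially. trunc (real (Suc n)) z = z"
        by (intro eventually_mono[OF eventually_ge_at_top[of n0]]) (simp add: trunc_def)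
      then show "(\<lambda>n. trunc (real (Suc n)) z) \<longlonglongrightarrow> z" by (rule tendsto_eventually)
    qed
    show "integrable D (\<lambda>z. \<bar>z\<bar>)" using law_integrable by (rule integrable_abs)
    show "AE z in D. norm (trunc (real (Suc n)) z) \<le> \<bar>z\<bar>" for n
      by (rule AE_I2) (simp add: trunc_def)
    show "(\<lambda>z. trunc (real (Suc n)) z) \<in> borel_measurable D" for n
      using trunc_measurable by simp
  qed simp
  then have "\<forall>\<^sub>F n in sequentially. \<mu> - \<eta> < (\<integral>z. trunc (real (Suc n)) z \<partial>D)"
    using assms by (intro order_tendstoD(1)) auto
  then obtain n where "\<mu> - \<eta> < (\<integral>z. trunc (real (Suc n)) z \<partial>D)"
    using eventually_happens'[OF sequentially_bot] by blast
  then show thesis by (intro that[of "real (Suc n)"]) auto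
qed

text \<open>Ruin has occurred by time \<open>n = Max I\<close>. The large claims contribute
  \<open>(1 + \<eta>) * x + (1 - \<mu> + \<eta>) * n\<close>, the others at least
  \<open>(\<mu> - \<eta>) * n - \<eta> * x\<close>; the slacks cancel and leave more than
  \<open>x + n\<close>.\<close>

lemma ruin_superset:
  assumes I: "I \<subseteq> {1..N}" "card I = k" and x: "x > 0" and K: "K < a * x"
    and nonneg: "\<And>i. i \<ge> 1 \<Longrightarrow> 0 \<le> B i \<omega>"
    and \<omega>: "\<omega> \<in> jumps (W x) I ((1 + \<eta>) * x + (1 - \<mu> + \<eta>) * Max I)"
      "\<omega> \<in> quiet I N (Max I) (e * x) K ((\<mu> - \<eta>) * Max I - \<eta> * x)"
  shows "\<omega> \<in> ruin x"
proof -
  define n where "n = Max I"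
  have fin: "finite I" using I by (auto intro: finite_subset)
  have In: "I \<subseteq> {1..n}" using I fin by (auto simp: n_def)
  have "capped x (B i \<omega>) = B i \<omega>" if "i \<in> I" for i
    using \<omega>(1) that by (auto simp: jumps_def)
  then have "(\<Sum>i\<in>I. capped x (B i \<omega>)) = (\<Sum>i\<in>I. B i \<omega>)" by (intro sum.cong) auto
  then have 1: "(1 + \<eta>) * x + (1 - \<mu> + \<eta>) * n < (\<Sum>i\<in>I. capped x (B i \<omega>))"
    using \<omega>(1) by (simp add: jumps_def n_def)
  have "trunc K (B i \<omega>) \<le> capped x (B i \<omega>)" if "i \<ge> 1" for i
    using nonneg[OF that] K by (auto simp: trunc_def indicator_def)
  then have "(\<Sum>i\<in>{1..n} - I. trunc K (B i \<omega>)) \<le> (\<Sum>i\<in>{1..n} - I. capped x (B i \<omega>))"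
    by (intro sum_mono) auto
  then have 2: "(\<mu> - \<eta>) * n - \<eta> * x < (\<Sum>i\<in>{1..n} - I. capped x (B i \<omega>))"
    using \<omega>(2) by (simp add: quiet_def n_def)
  have "(\<Sum>i=1..n. capped x (B i \<omega>)) = (\<Sum>i\<in>{1..n} - I. capped x (B i \<omega>)) + (\<Sum>i\<in>I. capped x (B i \<omega>))"
    using In by (intro sum.subset_diff) auto
  then have "x < reinsured_walk B a x n \<omega>"
    using 1 2 by (simp add: reinsured_walk_eq algebra_simps)
  then show ?thesis using \<omega>(1) by (auto simp: ruin_def jumps_def)
qed

lemma AE_claims_nonneg: "AE \<omega> in M. \<forall>i\<ge>1. 0 \<le> B i \<omega>"
proof -
  have "AE \<omega> in M. 1 \<le> i \<longrightarrow> 0 \<le> B i \<omega>" for i :: nat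
  proof (cases "1 \<le> i")
    case True
    have "AE \<omega> in M. 0 \<le> B i \<omega>" by (rule AE_claim[OF True law_nonneg]) simp
    then show ?thesis by eventually_elim simp
  qed simp
  then show ?thesis by (simp add: AE_all_countable)
qed

text \<open>Intersecting with quietness makes the events for different \<open>I\<close> disjoint, so
  their probabilities add without correction terms. The horizon satisfies
  \<open>N \<le> C * x\<close>, which is what makes the quietness errors small for large
  \<open>x\<close>.\<close>

lemma ruin_lower_bound:
  assumes \<eta>: "\<eta> > 0" "\<eta> < 1" and x: "x \<ge> 1" and K: "K > 0" "K < a * x" "\<mu> - \<eta> \<le> (\<integral>z. trunc K z \<partial>D)"
    and kx: "real k * (\<integral>z. trunc K z \<partial>D) \<le> \<eta> * x / 2"
    and c: "c = 1 - \<mu> + \<eta>" "c > 0" and C: "C = real k * a / c + 1"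
  shows "(smear D (W x) ^^ k) (subset_count k c) ((1 + \<eta>) * x)
      * (1 - C * (x * V (e * x)) - exp (- (\<eta>\<^sup>2 / (2 * C * K\<^sup>2) * x))) \<le> prob (ruin x)"
proof -
  define N where "N = nat \<lceil>real k * (a * x) / c\<rceil>"
  have pos: "0 < real k * (a * x) / c" using k_pos a_pos x c by simp
  have Nge: "real k * (a * x) / c \<le> real N" unfolding N_def by linarith
  then have N: "real k * (a * x) \<le> c * real N" using c(2) by (simp add: field_simps)
  have N1: "N \<ge> 1" using pos unfolding N_def by linarith
  have "real N \<le> real k * (a * x) / c + 1" unfolding N_def using pos by linarith
  also have "\<dots> \<le> C * x" using x by (simp add: C algebra_simps)
  finally have NC: "real N \<le> C * x" .
  have C0: "C > 0" using k_pos a_pos c by (auto simp: C intro!: add_nonneg_pos divide_nonneg_pos)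
  define \<nu> where "\<nu> = (\<integral>z. trunc K z \<partial>D)"
  let ?S = "{I. I \<subseteq> {1..N} \<and> card I = k}"
  let ?j = "\<lambda>I. jumps (W x) I ((1 + \<eta>) * x + c * Max I)"
  let ?q = "\<lambda>I. quiet I N (Max I) (e * x) K ((\<mu> - \<eta>) * Max I - \<eta> * x)"
  let ?b = "1 - C * (x * V (e * x)) - exp (- (\<eta>\<^sup>2 / (2 * C * K\<^sup>2) * x))"
  have fin: "finite ?S" by (rule finite_subset[of _ "Pow {1..N}"]) auto
  have ev: "?j I \<inter> ?q I \<in> events" and le: "prob (?j I) * ?b \<le> prob (?j I \<inter> ?q I)" if I: "I \<in> ?S" for I
  proof -
    have IN: "I \<subseteq> {1..N}" "card I = k" "finite I" "I \<noteq> {}"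
      using I k_pos by (auto intro: finite_subset)
    define n where "n = Max I"
    have n: "n \<in> I" "n \<le> N" "I \<subseteq> {1..n}" using IN Max_in[of I] by (auto simp: n_def)
    have "card ({1..n} - I) = n - k" using n(3) IN by (simp add: card_Diff_subset)
    moreover have "k \<le> n" using card_mono[OF _ n(3)] IN by simp
    ultimately have "real (card ({1..n} - I)) * \<nu> = real n * \<nu> - real k * \<nu>"
      by (simp add: of_nat_diff algebra_simps)
    moreover have "(\<mu> - \<eta>) * real n \<le> real n * \<nu>"
      using mult_right_mono[OF K(3), of "real n"] by (simp add: \<nu>_def mult.commute)
    \<comment> \<open>The slack \<open>\<eta> * x\<close> is halved: one half covers the mean of the
      \<open>k\<close> removed indices, the other is the deviation allowed to Hoeffding's
      inequality.\<close>
    ultimately have w: "(\<mu> - \<eta>) * real n - \<eta> * x \<le> real (card ({1..n} - I)) * \<nu> - \<eta> * x / 2"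
      using kx by (simp add: \<nu>_def)
    have eps: "\<eta> * x / 2 > 0" using \<eta> x by simp
    note Q = quiet_bound[OF law_nonneg IN(1) n(2) N1 _ K(1) eps w[unfolded \<nu>_def], where A = "W x" and t = "e * x"]
    have j: "?j I \<in> events" using IN by (intro jumps_events) auto
    then show "?j I \<inter> ?q I \<in> events" using Q(1) by (auto simp: n_def)
    have "real N * V (e * x) \<le> C * (x * V (e * x))"
      using mult_right_mono[OF NC, of "V (e * x)"] by (simp add: mult.assoc)
    moreover have "exp (- 2 * (\<eta> * x / 2)\<^sup>2 / (real N * K\<^sup>2)) \<le> exp (- (\<eta>\<^sup>2 / (2 * C * K\<^sup>2) * x))"
    proof -
      have "\<eta>\<^sup>2 / (2 * C * K\<^sup>2) * x = 2 * (\<eta> * x / 2)\<^sup>2 / (C * x * K\<^sup>2)"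
        using x C0 K(1) by (simp add: field_simps power2_eq_square)
      also have "\<dots> \<le> 2 * (\<eta> * x / 2)\<^sup>2 / (real N * K\<^sup>2)"
        using NC N1 K(1) C0 x by (intro divide_left_mono mult_right_mono) auto
      finally show ?thesis by simp
    qed
    ultimately have "?b \<le> 1 - real N * V (e * x) - exp (- 2 * (\<eta> * x / 2)\<^sup>2 / (real N * K\<^sup>2))" by linarith
    then have "prob (?j I) * ?b \<le> prob (?j I) * (1 - real N * V (e * x) - exp (- 2 * (\<eta> * x / 2)\<^sup>2 / (real N * K\<^sup>2)))"
      by (intro mult_left_mono) auto
    also have "\<dots> \<le> prob (?j I \<inter> ?q I)" unfolding n_def[symmetric] by (rule Q(2)) simp
    finally show "prob (?j I) * ?b \<le> prob (?j I \<inter> ?q I)" .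
  qed
  \<comment> \<open>The threshold \<open>e * x\<close> is both the lower end of the window and the
    upper limit for the quiet claims, so \<open>\<omega>\<close> determines
    \<open>I\<close>.\<close>
  have recover: "I = {i\<in>{1..N}. e * x < B i \<omega>}" if "I \<in> ?S" "\<omega> \<in> ?j I \<inter> ?q I" for I \<omega>
  proof -
    have "I \<subseteq> {1..N}" "\<forall>i\<in>I. e * x < B i \<omega>" using that by (simp_all add: jumps_def)
    moreover have "\<forall>i\<in>{1..N} - I. \<not> e * x < B i \<omega>" using that by (simp add: quiet_def not_less)
    ultimately show ?thesis by blast
  qed
  have disj: "disjoint_family_on (\<lambda>I. ?j I \<inter> ?q I) ?S"
    unfolding disjoint_family_on_def
  proof (intro ballI impI, rule ccontr)
    fix I I' assume I: "I \<in> ?S" "I' \<in> ?S" "I \<noteq> I'" "(?j I \<inter> ?q I) \<inter> (?j I' \<inter> ?q I') \<noteq> {}"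
    then obtain \<omega> where "\<omega> \<in> ?j I \<inter> ?q I" "\<omega> \<in> ?j I' \<inter> ?q I'" by blast
    with recover[OF I(1), of \<omega>] recover[OF I(2), of \<omega>] I(3) show False by argo
  qed
  have "(smear D (W x) ^^ k) (subset_count k c) ((1 + \<eta>) * x) = (\<Sum>I\<in>?S. prob (?j I))"
    by (rule sum_prob_jumps[OF _ _ _ N k_pos c(2), symmetric]) (use \<eta> x in auto)
  then have "(smear D (W x) ^^ k) (subset_count k c) ((1 + \<eta>) * x) * ?b = (\<Sum>I\<in>?S. prob (?j I) * ?b)"
    by (simp only: sum_distrib_right)
  also have "\<dots> \<le> (\<Sum>I\<in>?S. prob (?j I \<inter> ?q I))" by (rule sum_mono) (rule le)
  also have "\<dots> = prob (\<Union>I\<in>?S. ?j I \<inter> ?q I)"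
    using fin ev disj by (intro finite_measure_finite_Union[symmetric]) auto
  also have "\<dots> \<le> prob (ruin x)"
  proof (rule finite_measure_mono_AE[OF _ ruin_events])
    show "AE \<omega> in M. \<omega> \<in> (\<Union>I\<in>?S. ?j I \<inter> ?q I) \<longrightarrow> \<omega> \<in> ruin x"
      using AE_claims_nonneg
    proof eventually_elim
      case (elim \<omega>)
      show ?case
      proof
        assume "\<omega> \<in> (\<Union>I\<in>?S. ?j I \<inter> ?q I)"
        then obtain I where I: "I \<subseteq> {1..N}" "card I = k" "\<omega> \<in> ?j I" "\<omega> \<in> ?q I" by auto
        show "\<omega> \<in> ruin x"
          by (rule ruin_superset[OF I(1,2) _ K(2) _ I(3)[unfolded c(1)] I(4)]) (use x elim in auto)
      qed
    qed
  qed
  finally show ?thesis .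
qed

lemma ruin_lower:
  assumes \<eta>: "0 < \<eta>" "\<eta> < 1" and y: "y < \<Gamma> k (1 + \<eta>) / (1 - \<mu> + \<eta>) ^ k"
  shows "\<forall>\<^sub>F x in at_top. y < prob (ruin x) / (x * V x) ^ k"
proof -
  define c where "c = 1 - \<mu> + \<eta>"
  have c: "c > 0" using \<eta> mu_less_1 by (simp add: c_def)
  define C where "C = real k * a / c + 1"
  have C: "C > 0" using k_pos a_pos c by (auto simp: C_def intro!: add_nonneg_pos divide_nonneg_pos)
  obtain K where K: "K > 0" "\<mu> - \<eta> \<le> (\<integral>z. trunc K z \<partial>D)"
    using trunc_mean_close[OF \<eta>(1)] by auto
  let ?T = "\<lambda>x. (smear D (W x) ^^ k) (subset_count k c) ((1 + \<eta>) * x)"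
  let ?b = "\<lambda>x. 1 - C * (x * V (e * x)) - exp (- (\<eta>\<^sup>2 / (2 * C * K\<^sup>2) * x))"
  have "((\<lambda>x. (x * V x) * (V (e * x) / V x)) \<longlongrightarrow> 0 * e powr - \<alpha>) at_top"
    by (intro tendsto_mult x_tail_null tail_regular e_pos)
  moreover have "(x * V x) * (V (e * x) / V x) = x * V (e * x)" for x
    using tail_pos[of x] by simp
  ultimately have xV: "((\<lambda>x. x * V (e * x)) \<longlongrightarrow> 0) at_top" by simp
  have exp0: "((\<lambda>x. exp (- (\<theta> * x))) \<longlongrightarrow> 0) at_top" if "\<theta> > 0" for \<theta> :: real
    using that by real_asymp
  have "((\<lambda>x. exp (- (\<eta>\<^sup>2 / (2 * C * K\<^sup>2) * x))) \<longlongrightarrow> 0) at_top"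
    by (rule exp0) (use \<eta> C K in simp)
  with xV have "(?b \<longlongrightarrow> 1 - C * 0 - 0) at_top"
    by (intro tendsto_diff tendsto_mult tendsto_const)
  then have "((\<lambda>x. ?T x / (x * V x) ^ k * ?b x) \<longlongrightarrow> \<Gamma> k (1 + \<eta>) / c ^ k * (1 - C * 0 - 0)) at_top"
    by (intro tendsto_mult subset_count_smear_limit c k_pos)
  then have "\<forall>\<^sub>F x in at_top. y < ?T x / (x * V x) ^ k * ?b x"
    using y by (intro order_tendstoD) (auto simp: c_def)
  moreover have "\<forall>\<^sub>F x in at_top. K / a < x" by (rule eventually_gt_at_top)
  moreover have "\<forall>\<^sub>F x in at_top. real k * (\<integral>z. trunc K z \<partial>D) * 2 / \<eta> \<le> x" by (rule eventually_ge_at_top)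
  ultimately show ?thesis
    using eventually_ge_at_top[of 1]
  proof eventually_elim
    case (elim x)
    have "?T x * ?b x \<le> prob (ruin x)"
    proof (rule ruin_lower_bound[OF \<eta> elim(4) K(1) _ K(2) _ c_def c C_def])
      show "K < a * x" using elim(2) a_pos by (simp add: pos_divide_less_eq mult.commute)
      have "real k * (\<integral>z. trunc K z \<partial>D) * 2 \<le> x * \<eta>" using elim(3) \<eta> by (simp add: pos_divide_le_eq)
      then show "real k * (\<integral>z. trunc K z \<partial>D) \<le> \<eta> * x / 2" by (simp add: mult.commute)
    qed
    then have "?T x * ?b x / (x * V x) ^ k \<le> prob (ruin x) / (x * V x) ^ k"
      using elim by (intro divide_right_mono) auto
    with elim(1) show ?case by simp
  qed
qed

text \<open>Both bounds are continuous in the slack \<eta> and coincide at 0. For each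
  \<open>y\<close> on either side of the limit, some positive slack already separates the bound from
  \<open>y\<close>.\<close>

lemma ruin_limit:
  "((\<lambda>x. ruin_prob M B a x / (x * V x) ^ k) \<longlongrightarrow> \<Gamma> k 1 / (1 - \<mu>) ^ k) at_top"
  unfolding ruin_prob_eq
proof (rule order_tendstoI)
  have \<mu>: "1 - \<mu> > 0" using mu_less_1 by simp
  {
    fix y assume y: "y < \<Gamma> k 1 / (1 - \<mu>) ^ k"
    have "((\<lambda>\<eta>. \<Gamma> k (1 + \<eta>) / (1 - \<mu> + \<eta>) ^ k) \<longlongrightarrow> \<Gamma> k (1 + 0) / (1 - \<mu> + 0) ^ k) (at_right 0)"
      using \<mu> by (intro tendsto_divide tendsto_power tendsto_add tendsto_const tendsto_ident_at
          isCont_tendsto_compose[OF isCont_Gamma]) auto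
    then have "\<forall>\<^sub>F \<eta> in at_right 0. y < \<Gamma> k (1 + \<eta>) / (1 - \<mu> + \<eta>) ^ k"
      using y by (intro order_tendstoD) auto
    moreover have "\<forall>\<^sub>F \<eta> in at_right 0. \<eta> \<in> {0<..<1 :: real}"
      by (rule eventually_at_right_real) simp
    ultimately have "\<forall>\<^sub>F \<eta> in at_right 0. y < \<Gamma> k (1 + \<eta>) / (1 - \<mu> + \<eta>) ^ k \<and> \<eta> \<in> {0<..<1}"
      by (rule eventually_conj)
    then obtain \<eta> where "y < \<Gamma> k (1 + \<eta>) / (1 - \<mu> + \<eta>) ^ k" "0 < \<eta>" "\<eta> < 1"
      using eventually_happens'[of "at_right (0::real)"] by auto
    then show "\<forall>\<^sub>F x in at_top. y < prob (ruin x) / (x * V x) ^ k"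
      by (intro ruin_lower)
  }
  {
    fix y assume y: "\<Gamma> k 1 / (1 - \<mu>) ^ k < y"
    have "((\<lambda>\<eta>. \<Gamma> k (1 - \<eta>) / (1 - \<mu> - \<eta>) ^ k) \<longlongrightarrow> \<Gamma> k (1 - 0) / (1 - \<mu> - 0) ^ k) (at_right 0)"
      using \<mu> by (intro tendsto_divide tendsto_power tendsto_diff tendsto_const tendsto_ident_at
          isCont_tendsto_compose[OF isCont_Gamma]) auto
    then have "\<forall>\<^sub>F \<eta> in at_right 0. \<Gamma> k (1 - \<eta>) / (1 - \<mu> - \<eta>) ^ k < y"
      using y by (intro order_tendstoD) auto
    moreover have "\<forall>\<^sub>F \<eta> in at_right 0. \<eta> \<in> {0<..<min e (1 - \<mu>)}"
      by (rule eventually_at_right_real) (use \<mu> e_pos in auto)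
    ultimately have "\<forall>\<^sub>F \<eta> in at_right 0. \<Gamma> k (1 - \<eta>) / (1 - \<mu> - \<eta>) ^ k < y \<and> \<eta> \<in> {0<..<min e (1 - \<mu>)}"
      by (rule eventually_conj)
    then obtain \<eta> where "\<Gamma> k (1 - \<eta>) / (1 - \<mu> - \<eta>) ^ k < y" "0 < \<eta>" "\<eta> < e" "\<eta> < 1 - \<mu>"
      using eventually_happens'[of "at_right (0::real)"] by auto
    then show "\<forall>\<^sub>F x in at_top. prob (ruin x) / (x * V x) ^ k < y"
      by (intro ruin_upper) auto
  }
qed

end

theorem proposition4p1:
  fixes M :: "'a measure" and B :: "nat \<Rightarrow> 'a \<Rightarrow> real"
    and L :: "real \<Rightarrow> real" and a \<alpha> :: real
  assumes "prob_space M"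
    and indep: "prob_space.indep_vars M (\<lambda>_. borel) B {1..}"
    and ident: "\<And>i. i \<ge> 1 \<Longrightarrow> distr M borel (B i) = distr M borel (B 1)"
    and nonneg: "\<And>i. i \<ge> 1 \<Longrightarrow> AE \<omega> in M. B i \<omega> \<ge> 0"
    and integrable: "integrable M (B 1)"
    and net_profit: "integral\<^sup>L M (B 1) < 1"
    and "a > 0"
    and "\<alpha> > 1"
    and tail: "\<And>x. x > 0 \<Longrightarrow> measure M {\<omega> \<in> space M. B 1 \<omega> > x} = L x * x powr (- \<alpha>)"
    and "slowly_varying L"
    and "1 / a \<notin> \<int>"
  shows "\<exists>C>0. (\<lambda>x. ruin_prob M B a x)
           \<sim>[at_top] (\<lambda>x. (L x * x powr (- (\<alpha> - 1))) ^ nat \<lceil>1 / a\<rceil> * C)"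
proof -
  define D where "D = distr M borel (B 1)"
  interpret iid_claims M B D
    unfolding iid_claims_def iid_claims_axioms_def D_def using assms(1) indep ident by blast
  have B1: "B 1 \<in> borel_measurable M" by (rule measurable_claim) simp
  have V_eq: "measure D {x<..} = L x * x powr - \<alpha>" if "x > 0" for x
    using tail[OF that] prob_claim[of 1 "{x<..}"] by simp
  have slow: "((\<lambda>x. L (t * x) / L x) \<longlongrightarrow> 1) at_top" if "t > 0" for t
    using \<open>slowly_varying L\<close> that by (simp add: slowly_varying_def)
  have V_pos: "measure D {x<..} > 0" for x
  proof -
    \<comment> \<open>Scaling by 1: a zero of \<open>L\<close> would give the quotient 0, since
      division by zero is 0. So the tail is eventually nonzero, hence positive everywhere by
      monotonicity.\<close>
    have "\<forall>\<^sub>F y in at_top. 0 < L (1 * y) / L y"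
      by (rule order_tendstoD(1)[OF slow]) auto
    then have "\<forall>\<^sub>F y in at_top. L y \<noteq> 0 \<and> y > 0 \<and> y \<ge> x"
      using eventually_gt_at_top[of 0] eventually_ge_at_top[of x] by eventually_elim auto
    then obtain y where y: "L y \<noteq> 0" "y > 0" "y \<ge> x"
      using eventually_happens'[of "at_top :: real filter"] by auto
    then have "measure D {y<..} \<noteq> 0" by (simp add: V_eq)
    then have "measure D {y<..} > 0" by (simp add: less_le)
    also have "measure D {y<..} \<le> measure D {x<..}"
      using y by (intro law.finite_measure_mono) auto
    finally show ?thesis .
  qed
  have V_regular: "((\<lambda>x. measure D {t * x<..} / measure D {x<..}) \<longlongrightarrow> t powr - \<alpha>) at_top" if t: "t > 0" for t
  proof -
    have "((\<lambda>x. L (t * x) / L x * t powr - \<alpha>) \<longlongrightarrow> 1 * t powr - \<alpha>) at_top"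
      by (intro tendsto_intros slow t)
    moreover have "\<forall>\<^sub>F x in at_top. L (t * x) / L x * t powr - \<alpha> = measure D {t * x<..} / measure D {x<..}"
      using eventually_gt_at_top[of 0]
      by eventually_elim (use t in \<open>simp add: V_eq powr_mult\<close>)
    ultimately have "((\<lambda>x. measure D {t * x<..} / measure D {x<..}) \<longlongrightarrow> 1 * t powr - \<alpha>) at_top"
      by (rule Lim_transform_eventually)
    then show ?thesis by simp
  qed
  define k where "k = nat \<lceil>1 / a\<rceil>"
  have inv: "0 < 1 / a" "1 / a \<noteq> real_of_int \<lceil>1 / a\<rceil>"
    using \<open>a > 0\<close> Ints_of_int[of "\<lceil>1 / a\<rceil>"] \<open>1 / a \<notin> \<int>\<close> by (simp, metis)
  \<comment> \<open>The ceiling always gives the first strict inequality; the second is strict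
    because \<open>1 / a\<close> is not an integer.\<close>
  then have k: "real k - 1 < 1 / a" "1 / a < real k" unfolding k_def by linarith+
  interpret reinsured_claims M B D \<alpha> a k
  proof unfold_locales
    show "AE z in D. 0 \<le> z"
      unfolding D_def using nonneg[of 1] B1 by (subst AE_distr_iff) auto
    show "integrable D (\<lambda>z. z)"
      unfolding D_def using integrable B1 by (subst integrable_distr_eq) auto
    show "(\<integral>z. z \<partial>D) < 1"
      unfolding D_def using net_profit B1 by (subst integral_distr) auto
    show "(real k - 1) * a < 1" "1 < real k * a" using k \<open>a > 0\<close> by (auto simp: field_simps)
    show "0 < \<alpha>" using \<open>\<alpha> > 1\<close> by simp
  qed (fact V_pos V_regular \<open>\<alpha> > 1\<close> \<open>a > 0\<close>)+
  define C where "C = \<Gamma> k 1 / (1 - \<mu>) ^ k"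
  have C: "C > 0"
    unfolding C_def using mu_less_1 by (intro divide_pos_pos zero_less_power Gamma_pos k_high) simp
  have "(\<lambda>x. ruin_prob M B a x) \<sim>[at_top] (\<lambda>x. C * (x * V x) ^ k)"
  proof (rule asymp_equivI'_const)
    show "((\<lambda>x. ruin_prob M B a x / (x * V x) ^ k) \<longlongrightarrow> C) at_top"
      unfolding C_def by (rule ruin_limit)
  qed (use C in simp)
  also have "(\<lambda>x. C * (x * V x) ^ k) \<sim>[at_top] (\<lambda>x. (L x * x powr (- (\<alpha> - 1))) ^ k * C)"
  proof (rule asymp_equiv_refl_ev)
    show "\<forall>\<^sub>F x in at_top. C * (x * V x) ^ k = (L x * x powr (- (\<alpha> - 1))) ^ k * C"
      using eventually_gt_at_top[of 0]
    proof eventually_elim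
      case (elim x)
      have "x * V x = L x * x powr (- (\<alpha> - 1))"
        using elim powr_add[of x 1 "- \<alpha>"] by (simp add: V_eq)
      then show ?case by simp
    qed
  qed
  finally show ?thesis using C unfolding k_def by blast
qed

end
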